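(* Let $\mathfrak{S}$ be the nonself-adjoint $2$-graph algebra associated to a Cuntz-type representation $(S,T)$ of a single vertex $2$-graph $\mathbb{F}_\theta^+$ on a Hilbert space $\mathcal{H}$, and let $\mathfrak{M}$ be the enveloping von Neumann algebra (the von Neumann algebra generated by $\mathfrak{S}$). Then the first structure projection $P$ of $\mathfrak{S}$ satisfies the following properties: (1) $P\mathfrak{S}P$ is self-adjoint; (2) $P^\perp\mathcal{H}$ is an $\mathfrak{S}$-invariant subspace; and (3) $\mathfrak{S}=\mathfrak{M}P+P^\perp\mathfrak{S}P^\perp$.
   Context: Single vertex $2$-graph: for positive integers $m,n$ (with $m>1$ or $n>1$) and a permutation $\theta$ of $\{1,\ldots,m\}\times\{1,\ldots,n\}$, $\mathbb{F}_\theta^+$ is the unital cancellative semigroup generated by $e_1,\ldots,e_m,f_1,\ldots,f_n$, where the $e_i$ generate a copy of the free semigroup $\mathbb{F}_m^+$, the $f_j$ generate a copy of $\mathbb{F}_n^+$, and $e_if_j=f_{j'}e_{i'}$ whenever $\theta(i,j)=(i',j')$. Every $w\in\mathbb{F}_\theta^+$ is uniquely $w=e_uf_v$; its degree is $d(w)=(|u|,|v|)$. An isometric representation $(S,T)$ of $\mathbb{F}_\theta^+$ on $\mathcal{H}$ consists of $S=[S_1,\ldots,S_m]$ and $T=[T_1,\ldots,T_n]$ with $S_i^*S_j=\delta_{i,j}I$, $T_k^*T_l=\delta_{k,l}I$, and $S_iT_j=T_{j'}S_{i'}$ whenever $\theta(i,j)=(i',j')$. It is of Cuntz-type if $\sum_iS_iS_i^*=I=\sum_jT_jT_j^*$.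 For $w=e_uf_v$, $(ST)_w=S_uT_v$. The nonself-adjoint $2$-graph algebra $\mathfrak{S}$ generated by $(S,T)$ is the unital WOT-closed algebra generated by all $S_i,T_j$. A free semigroup algebra is the unital WOT-closed algebra generated by finitely many (here at least two) isometries $V_1,\ldots,V_N$ with $V_i^*V_j=\delta_{i,j}I$. It is analytic if there is an injective WOT-continuous homomorphism, sending generators to generators, into $\mathcal{L}_N$, the free semigroup algebra generated by the left-regular representation of $\mathbb{F}_N^+$ on $\ell^2(\mathbb{F}_N^+)$. The structure projection of a free semigroup algebra $\mathfrak{T}$ on $\mathcal{H}$ is the unique projection $Q\in\mathfrak{T}$ such that: $Q\mathfrak{T}Q$ is self-adjoint; $\mathfrak{T}Q=\mathfrak{N}Q$ where $\mathfrak{N}$ is the von Neumann algebra generated by $\mathfrak{T}$; $Q^\perp\mathcal{H}$ is $\mathfrak{T}$-invariant; and $Q^\perp$ is the largest projection onto an invariant subspace on which the restriction of $\mathfrak{T}$ is analytic (existence and uniqueness are known). For $k,l>0$, $\mathfrak{S}_{k,l}$ is the free semigroup algebra generated by the row-isometry $[ST]_{k,l}=[(ST)_w:d(w)=(k,l)]$, and $P_{k,l}$ is its structure projection. The first structure projection of $\mathfrak{S}$ is $P=\bigwedge_{k,l>0}P_{k,l}$. *)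

theory Defs
  imports "HOL-Analysis.Analysis" "HOL-Combinatorics.Permutations"
begin

section \<open>Complex Hilbert spaces\<close>

text \<open>
  The underlying real inner product is the real part of the complex one, so that the norm and
  the topology are the ones inherited from \<^class>\<open>real_inner\<close>.
  The complex inner product is conjugate linear in its first argument.
\<close>

class complex_inner = real_inner +
  fixes scaleC :: "complex \<Rightarrow> 'a \<Rightarrow> 'a" (infixr "*\<^sub>C" 75)
    and cinner :: "'a \<Rightarrow> 'a \<Rightarrow> complex"
  assumes scaleC_add_right: "a *\<^sub>C (x + y) = a *\<^sub>C x + a *\<^sub>C y"
    and scaleC_add_left: "(a + b) *\<^sub>C x = a *\<^sub>C x + b *\<^sub>C x"
    and scaleC_scaleC: "a *\<^sub>C (b *\<^sub>C x) = (a * b) *\<^sub>C x"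
    and scaleR_scaleC: "scaleR r x = complex_of_real r *\<^sub>C x"
    and cinner_commute: "cinner x y = cnj (cinner y x)"
    and cinner_add_right: "cinner x (y + z) = cinner x y + cinner x z"
    and cinner_scaleC_right: "cinner x (a *\<^sub>C y) = a * cinner x y"
    and inner_eq_Re_cinner: "inner x y = Re (cinner x y)"

class chilbert_space = complex_inner + complete_space

definition closed_csubspace :: "'a::complex_inner set \<Rightarrow> bool" where
  "closed_csubspace K \<longleftrightarrow> 0 \<in> K \<and> (\<forall>x\<in>K. \<forall>y\<in>K. x + y \<in> K) \<and>
     (\<forall>c. \<forall>x\<in>K. c *\<^sub>C x \<in> K) \<and> closed K"

text \<open>The orthogonal projection onto \<open>K\<close>, well defined if \<open>K\<close> is a closed subspace of a Hilbert space.\<close>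

definition proj :: "'a::complex_inner set \<Rightarrow> 'a \<Rightarrow> 'a" where
  "proj K x = (THE y. y \<in> K \<and> (\<forall>z\<in>K. cinner z (x - y) = 0))"


section \<open>Bounded operators and operator algebras\<close>

definition bounded_op :: "('a::complex_inner \<Rightarrow> 'a) \<Rightarrow> bool" where
  "bounded_op A \<longleftrightarrow> bounded_linear A \<and> (\<forall>c x. A (c *\<^sub>C x) = c *\<^sub>C A x)"

text \<open>On a Hilbert space the adjoint of a bounded operator exists and is unique.\<close>

definition adj :: "('a::complex_inner \<Rightarrow> 'a) \<Rightarrow> 'a \<Rightarrow> 'a" where
  "adj A = (THE B. \<forall>x y. cinner (A x) y = cinner x (B y))"

definition projection :: "('a::complex_inner \<Rightarrow> 'a) \<Rightarrow> bool" where
  "projection Q \<longleftrightarrow> bounded_op Q \<and> Q \<circ> Q = Q \<and> adj Q = Q"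

definition perp :: "('a::complex_inner \<Rightarrow> 'a) \<Rightarrow> 'a \<Rightarrow> 'a" where
  "perp Q = (\<lambda>x. x - Q x)"

definition self_adjoint_set :: "('a::complex_inner \<Rightarrow> 'a) set \<Rightarrow> bool" where
  "self_adjoint_set X \<longleftrightarrow> (\<forall>A\<in>X. adj A \<in> X)"

text \<open>
  The weak operator topology on the bounded operators: the coarsest topology making all
  maps \<open>A \<mapsto> \<langle>x, A y\<rangle>\<close> continuous. The topology on functions is the product topology.
\<close>

definition wot :: "('a::complex_inner \<Rightarrow> 'a) topology" where
  "wot = pullback_topology {A. bounded_op A} (\<lambda>A (x, y). cinner x (A y))
           (euclidean :: ('a \<times> 'a \<Rightarrow> complex) topology)"

definition operator_algebra :: "('a::complex_inner \<Rightarrow> 'a) set \<Rightarrow> bool" where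
  "operator_algebra X \<longleftrightarrow> (\<forall>A\<in>X. bounded_op A) \<and> (\<lambda>x. 0) \<in> X \<and>
     (\<forall>A\<in>X. \<forall>B\<in>X. (\<lambda>x. A x + B x) \<in> X) \<and> (\<forall>c. \<forall>A\<in>X. (\<lambda>x. c *\<^sub>C A x) \<in> X) \<and>
     (\<forall>A\<in>X. \<forall>B\<in>X. A \<circ> B \<in> X)"

text \<open>
  The WOT-closed algebra generated by \<open>G\<close> on the closed subspace \<open>K\<close>, where every member of
  \<open>G\<close> leaves \<open>K\<close> invariant. A bounded operator on \<open>K\<close> is encoded by its extension to the
  whole space that vanishes on the orthogonal complement of \<open>K\<close>; thus \<open>A\<close> restricted to \<open>K\<close>
  is \<open>A \<circ> proj K\<close>, the identity of \<open>K\<close> is \<open>proj K\<close>, and algebraic operations and the weak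
  operator topology are those of the whole space.
\<close>

definition wot_alg_on :: "'a::complex_inner set \<Rightarrow> ('a \<Rightarrow> 'a) set \<Rightarrow> ('a \<Rightarrow> 'a) set" where
  "wot_alg_on K G = \<Inter>{X. operator_algebra X \<and> closedin wot X \<and> proj K \<in> X \<and>
     (\<lambda>A. A \<circ> proj K) ` G \<subseteq> X}"

definition wot_alg :: "('a::complex_inner \<Rightarrow> 'a) set \<Rightarrow> ('a \<Rightarrow> 'a) set" where
  "wot_alg G = \<Inter>{X. operator_algebra X \<and> closedin wot X \<and> id \<in> X \<and> G \<subseteq> X}"

definition vn_alg :: "('a::complex_inner \<Rightarrow> 'a) set \<Rightarrow> ('a \<Rightarrow> 'a) set" where
  "vn_alg G = \<Inter>{X. operator_algebra X \<and> closedin wot X \<and> self_adjoint_set X \<and> id \<in> X \<and> G \<subseteq> X}"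

definition invariant_under :: "('a::complex_inner \<Rightarrow> 'a) set \<Rightarrow> 'a set \<Rightarrow> bool" where
  "invariant_under X K \<longleftrightarrow> closed_csubspace K \<and> (\<forall>A\<in>X. A ` K \<subseteq> K)"


section \<open>The space \<open>\<ell>\<^sup>2\<close>\<close>

typedef 'x ell2 = "{f :: 'x \<Rightarrow> complex. (\<lambda>x. (cmod (f x))\<^sup>2) summable_on UNIV}"
  by (rule exI[of _ "\<lambda>_. 0"]) simp

setup_lifting type_definition_ell2

lemma ell2_summable_mult:
  fixes f g :: "'x \<Rightarrow> complex"
  assumes "(\<lambda>x. (cmod (f x))\<^sup>2) summable_on UNIV" "(\<lambda>x. (cmod (g x))\<^sup>2) summable_on UNIV"
  shows "(\<lambda>x. cnj (f x) * g x) summable_on UNIV"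
proof -
  have "(\<lambda>x. norm (cnj (f x) * g x)) summable_on UNIV"
  proof (rule summable_on_comparison_test)
    show "(\<lambda>x. (cmod (f x))\<^sup>2 + (cmod (g x))\<^sup>2) summable_on UNIV"
      by (intro summable_on_add assms)
    fix x
    have "2 * (cmod (f x) * cmod (g x)) \<le> (cmod (f x))\<^sup>2 + (cmod (g x))\<^sup>2"
      using sum_squares_bound[of "cmod (f x)" "cmod (g x)"] by simp
    moreover have "0 \<le> cmod (f x) * cmod (g x)" by simp
    ultimately have "cmod (f x) * cmod (g x) \<le> (cmod (f x))\<^sup>2 + (cmod (g x))\<^sup>2"
      by linarith
    then show "norm (cnj (f x) * g x) \<le> (cmod (f x))\<^sup>2 + (cmod (g x))\<^sup>2"
      by (simp add: norm_mult)
  qed simp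
  then show ?thesis by (rule abs_summable_summable)
qed

lemma ell2_summable_add:
  fixes f g :: "'x \<Rightarrow> complex"
  assumes "(\<lambda>x. (cmod (f x))\<^sup>2) summable_on UNIV" "(\<lambda>x. (cmod (g x))\<^sup>2) summable_on UNIV"
  shows "(\<lambda>x. (cmod (f x + g x))\<^sup>2) summable_on UNIV"
proof (rule summable_on_comparison_test)
  show "(\<lambda>x. 2 * (cmod (f x))\<^sup>2 + 2 * (cmod (g x))\<^sup>2) summable_on UNIV"
    by (intro summable_on_add summable_on_cmult_right assms)
  fix x
  have "(cmod (f x + g x))\<^sup>2 \<le> (cmod (f x) + cmod (g x))\<^sup>2"
    by (intro power_mono norm_triangle_ineq) simp
  also have "\<dots> \<le> 2 * (cmod (f x))\<^sup>2 + 2 * (cmod (g x))\<^sup>2"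
    using sum_squares_bound[of "cmod (f x)" "cmod (g x)"] by (simp add: power2_sum)
  finally show "(cmod (f x + g x))\<^sup>2 \<le> 2 * (cmod (f x))\<^sup>2 + 2 * (cmod (g x))\<^sup>2" .
qed simp

lemma ell2_summable_scale:
  fixes f :: "'x \<Rightarrow> complex"
  assumes "(\<lambda>x. (cmod (f x))\<^sup>2) summable_on UNIV"
  shows "(\<lambda>x. (cmod (c * f x))\<^sup>2) summable_on UNIV"
  using summable_on_cmult_right[OF assms, of "(cmod c)\<^sup>2"]
  by (simp add: norm_mult power_mult_distrib)

instantiation ell2 :: (type) complex_inner
begin

lift_definition zero_ell2 :: "'a ell2" is "\<lambda>_. 0" by simp
lift_definition plus_ell2 :: "'a ell2 \<Rightarrow> 'a ell2 \<Rightarrow> 'a ell2" is "\<lambda>f g x. f x + g x"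
  by (rule ell2_summable_add)
lift_definition uminus_ell2 :: "'a ell2 \<Rightarrow> 'a ell2" is "\<lambda>f x. - f x" by simp
lift_definition minus_ell2 :: "'a ell2 \<Rightarrow> 'a ell2 \<Rightarrow> 'a ell2" is "\<lambda>f g x. f x - g x"
  subgoal for f g using ell2_summable_add[of f "\<lambda>x. - g x"] by simp
  done
lift_definition scaleC_ell2 :: "complex \<Rightarrow> 'a ell2 \<Rightarrow> 'a ell2" is "\<lambda>c f x. c * f x"
  by (rule ell2_summable_scale)
lift_definition scaleR_ell2 :: "real \<Rightarrow> 'a ell2 \<Rightarrow> 'a ell2" is "\<lambda>r f x. complex_of_real r * f x"
  by (rule ell2_summable_scale)
lift_definition cinner_ell2 :: "'a ell2 \<Rightarrow> 'a ell2 \<Rightarrow> complex"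
  is "\<lambda>f g. \<Sum>\<^sub>\<infinity>x. cnj (f x) * g x" .
definition inner_ell2 :: "'a ell2 \<Rightarrow> 'a ell2 \<Rightarrow> real" where
  "inner_ell2 f g = Re (cinner f g)"
definition norm_ell2 :: "'a ell2 \<Rightarrow> real" where
  "norm_ell2 f = sqrt (inner f f)"
definition sgn_ell2 :: "'a ell2 \<Rightarrow> 'a ell2" where
  "sgn_ell2 f = scaleR (inverse (norm f)) f"
definition dist_ell2 :: "'a ell2 \<Rightarrow> 'a ell2 \<Rightarrow> real" where
  "dist_ell2 f g = norm (f - g)"
definition uniformity_ell2 :: "('a ell2 \<times> 'a ell2) filter" where
  "uniformity_ell2 = (INF e\<in>{0<..}. principal {(x, y). dist x y < e})"
definition open_ell2 :: "'a ell2 set \<Rightarrow> bool" where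
  "open_ell2 U \<longleftrightarrow> (\<forall>x\<in>U. \<forall>\<^sub>F (x', y) in uniformity. x' = x \<longrightarrow> y \<in> U)"

lemma Re_cinner_ell2_self: "Re (cinner f f) = (\<Sum>\<^sub>\<infinity>x. (cmod (Rep_ell2 f x))\<^sup>2)"
proof -
  have "(\<lambda>x. cnj (Rep_ell2 f x) * Rep_ell2 f x) summable_on UNIV"
    using Rep_ell2[of f] by (intro ell2_summable_mult) simp_all
  then have "Re (cinner f f) = (\<Sum>\<^sub>\<infinity>x. Re (cnj (Rep_ell2 f x) * Rep_ell2 f x))"
    unfolding cinner_ell2.rep_eq by (rule infsum_Re[symmetric])
  also have "\<dots> = (\<Sum>\<^sub>\<infinity>x. (cmod (Rep_ell2 f x))\<^sup>2)"
    by (rule infsum_cong) (simp add: cmod_power2, simp add: power2_eq_square)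
  finally show ?thesis .
qed

instance
proof
  fix f g h :: "'a ell2" and a b :: complex and r s :: real
  show "f + g + h = f + (g + h)" "f + g = g + f" "0 + f = f" "- f + f = 0" "f - g = f + - g"
    by (transfer, simp add: fun_eq_iff)+
  show "r *\<^sub>R (f + g) = r *\<^sub>R f + r *\<^sub>R g" "(r + s) *\<^sub>R f = r *\<^sub>R f + s *\<^sub>R f"
    "r *\<^sub>R s *\<^sub>R f = (r * s) *\<^sub>R f" "1 *\<^sub>R f = f"
    by (transfer, simp add: fun_eq_iff algebra_simps)+
  show "a *\<^sub>C (f + g) = a *\<^sub>C f + a *\<^sub>C g" "(a + b) *\<^sub>C f = a *\<^sub>C f + b *\<^sub>C f"
    "a *\<^sub>C b *\<^sub>C f = (a * b) *\<^sub>C f" "r *\<^sub>R f = complex_of_real r *\<^sub>C f"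
    by (transfer, simp add: fun_eq_iff algebra_simps)+
  show com: "cinner f g = cnj (cinner g f)" for f g :: "'a ell2"
    by transfer (subst infsum_cnj[symmetric], simp add: mult.commute)
  show add: "cinner f (g + h) = cinner f g + cinner f h" for f g h :: "'a ell2"
    by transfer (simp add: distrib_left infsum_add ell2_summable_mult)
  show scale: "cinner f (a *\<^sub>C g) = a * cinner f g" for f g :: "'a ell2" and a
    by transfer (simp add: mult.left_commute infsum_cmult_right')
  show "inner f g = Re (cinner f g)" by (fact inner_ell2_def)
  show "inner f g = inner g f" by (simp add: inner_ell2_def com[of f g])
  have "cinner (f + g) h = cinner f h + cinner g h"
    by (simp add: com[of _ h] add)
  then show "inner (f + g) h = inner f h + inner g h" by (simp add: inner_ell2_def)
  have sr: "r *\<^sub>R f = complex_of_real r *\<^sub>C f" by transfer simp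
  have "cinner (r *\<^sub>R f) g = complex_of_real r * cinner f g"
    by (simp add: sr com[of _ g] scale)
  then show "inner (r *\<^sub>R f) g = r * inner f g" by (simp add: inner_ell2_def)
  show "0 \<le> inner f f" by (simp add: inner_ell2_def Re_cinner_ell2_self infsum_nonneg)
  have "f = 0" if "inner f f = 0"
  proof -
    have "(\<Sum>\<^sub>\<infinity>x. (cmod (Rep_ell2 f x))\<^sup>2) = 0"
      using that by (simp add: inner_ell2_def Re_cinner_ell2_self)
    moreover have "(\<lambda>x. (cmod (Rep_ell2 f x))\<^sup>2) summable_on UNIV" using Rep_ell2[of f] by simp
    ultimately have "(cmod (Rep_ell2 f x))\<^sup>2 = 0" for x
      using nonneg_infsum_le_0D[of "\<lambda>x. (cmod (Rep_ell2 f x))\<^sup>2" UNIV x] by simp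
    then have "Rep_ell2 f x = Rep_ell2 0 x" for x by (simp add: zero_ell2.rep_eq)
    then have "Rep_ell2 f = Rep_ell2 0" by blast
    then show ?thesis by (simp add: Rep_ell2_inject)
  qed
  moreover have "inner (0::'a ell2) 0 = 0"
    by (simp add: inner_ell2_def Re_cinner_ell2_self zero_ell2.rep_eq)
  ultimately show "inner f f = 0 \<longleftrightarrow> f = 0" by blast
qed (simp_all add: norm_ell2_def sgn_ell2_def dist_ell2_def uniformity_ell2_def open_ell2_def)

end

lemma norm_ell2_eq: "norm f = sqrt (\<Sum>\<^sub>\<infinity>x. (cmod (Rep_ell2 f x))\<^sup>2)"
  by (simp add: norm_ell2_def inner_ell2_def Re_cinner_ell2_self)

lemma ell2_sum_le_norm:
  assumes "finite F"
  shows "(\<Sum>x\<in>F. (cmod (Rep_ell2 f x))\<^sup>2) \<le> (norm f)\<^sup>2"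
proof -
  have "(\<Sum>x\<in>F. (cmod (Rep_ell2 f x))\<^sup>2) \<le> (\<Sum>\<^sub>\<infinity>x. (cmod (Rep_ell2 f x))\<^sup>2)"
    using Rep_ell2[of f] assms by (intro finite_sum_le_infsum) auto
  then show ?thesis by (simp add: norm_ell2_eq infsum_nonneg)
qed

lemma ell2_norm_leI:
  assumes "\<And>F. finite F \<Longrightarrow> (\<Sum>x\<in>F. (cmod (Rep_ell2 f x))\<^sup>2) \<le> e\<^sup>2" "0 \<le> e"
  shows "norm f \<le> e"
proof -
  have "(\<Sum>\<^sub>\<infinity>x. (cmod (Rep_ell2 f x))\<^sup>2) \<le> e\<^sup>2"
    using Rep_ell2[of f] assms(1) by (intro infsum_le_finite_sums) auto
  then show ?thesis using assms(2) by (simp add: norm_ell2_eq real_le_lsqrt infsum_nonneg)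
qed

instance ell2 :: (type) chilbert_space
proof
  fix X :: "nat \<Rightarrow> 'a ell2"
  assume X: "Cauchy X"
  have pt: "cmod (Rep_ell2 f x) \<le> norm f" for f :: "'a ell2" and x
    by (rule power2_le_imp_le) (use ell2_sum_le_norm[of "{x}" f] in simp_all)
  have "convergent (\<lambda>n. Rep_ell2 (X n) x)" for x
  proof (rule Cauchy_convergent, rule metric_CauchyI)
    fix e :: real assume "0 < e"
    then obtain M where M: "\<And>m n. M \<le> m \<Longrightarrow> M \<le> n \<Longrightarrow> dist (X m) (X n) < e"
      using metric_CauchyD[OF X] by blast
    have "dist (Rep_ell2 (X m) x) (Rep_ell2 (X n) x) < e" if "M \<le> m" "M \<le> n" for m n
      using M[OF that] pt[of "X m - X n" x] by (simp add: dist_norm minus_ell2.rep_eq)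
    then show "\<exists>M. \<forall>m\<ge>M. \<forall>n\<ge>M. dist (Rep_ell2 (X m) x) (Rep_ell2 (X n) x) < e" by blast
  qed
  then obtain l where l: "\<And>x. (\<lambda>n. Rep_ell2 (X n) x) \<longlonglongrightarrow> l x"
    unfolding convergent_def by metis
  have key: "\<exists>M. \<forall>n\<ge>M. \<forall>F. finite F \<longrightarrow> (\<Sum>x\<in>F. (cmod (Rep_ell2 (X n) x - l x))\<^sup>2) \<le> e\<^sup>2"
    if e: "0 < e" for e :: real
  proof -
    obtain M where M: "\<And>m n. M \<le> m \<Longrightarrow> M \<le> n \<Longrightarrow> dist (X m) (X n) < e"
      using metric_CauchyD[OF X e] by blast
    have "(\<Sum>x\<in>F. (cmod (Rep_ell2 (X n) x - l x))\<^sup>2) \<le> e\<^sup>2" if n: "M \<le> n" and F: "finite F" for n F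
    proof (rule LIMSEQ_le_const2)
      show "(\<lambda>m. \<Sum>x\<in>F. (cmod (Rep_ell2 (X n) x - Rep_ell2 (X m) x))\<^sup>2)
              \<longlonglongrightarrow> (\<Sum>x\<in>F. (cmod (Rep_ell2 (X n) x - l x))\<^sup>2)"
        by (intro tendsto_intros l)
      have "(\<Sum>x\<in>F. (cmod (Rep_ell2 (X n) x - Rep_ell2 (X m) x))\<^sup>2) \<le> e\<^sup>2" if "M \<le> m" for m
      proof -
        have "(\<Sum>x\<in>F. (cmod (Rep_ell2 (X n - X m) x))\<^sup>2) \<le> (norm (X n - X m))\<^sup>2"
          by (rule ell2_sum_le_norm[OF F])
        also have "\<dots> \<le> e\<^sup>2"
          using M[OF n that] by (intro power_mono) (simp_all add: dist_norm)
        finally show ?thesis by (simp add: minus_ell2.rep_eq)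
      qed
      then show "\<exists>N. \<forall>m\<ge>N. (\<Sum>x\<in>F. (cmod (Rep_ell2 (X n) x - Rep_ell2 (X m) x))\<^sup>2) \<le> e\<^sup>2"
        by blast
    qed
    then show ?thesis by blast
  qed
  obtain M where M: "\<And>F. finite F \<Longrightarrow> (\<Sum>x\<in>F. (cmod (Rep_ell2 (X M) x - l x))\<^sup>2) \<le> 1"
    using key[of 1] by auto
  have "(\<lambda>x. (cmod (Rep_ell2 (X M) x - l x))\<^sup>2) summable_on UNIV"
    using M by (intro nonneg_bdd_above_summable_on) (auto intro!: bdd_aboveI2[where M = 1])
  then have "(\<lambda>x. (cmod (- (Rep_ell2 (X M) x - l x) + Rep_ell2 (X M) x))\<^sup>2) summable_on UNIV"
    using Rep_ell2[of "X M"] by (intro ell2_summable_add) (simp_all only: norm_minus_cancel mem_Collect_eq)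
  then have "(\<lambda>x. (cmod (l x))\<^sup>2) summable_on UNIV" by simp
  then have Rl: "Rep_ell2 (Abs_ell2 l) = l" by (simp add: Abs_ell2_inverse)
  have "X \<longlonglongrightarrow> Abs_ell2 l"
  proof (rule metric_LIMSEQ_I)
    fix r :: real assume "0 < r"
    then obtain M where M: "\<And>n F. M \<le> n \<Longrightarrow> finite F \<Longrightarrow>
        (\<Sum>x\<in>F. (cmod (Rep_ell2 (X n) x - l x))\<^sup>2) \<le> (r / 2)\<^sup>2"
      using key[of "r / 2"] by auto
    have "dist (X n) (Abs_ell2 l) < r" if "M \<le> n" for n
    proof -
      have "norm (X n - Abs_ell2 l) \<le> r / 2"
        using M[OF that] \<open>0 < r\<close> by (intro ell2_norm_leI) (simp_all add: minus_ell2.rep_eq Rl)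
      then show ?thesis using \<open>0 < r\<close> by (simp add: dist_norm)
    qed
    then show "\<exists>no. \<forall>n\<ge>no. dist (X n) (Abs_ell2 l) < r" by blast
  qed
  then show "convergent X" by (auto simp: convergent_def)
qed


section \<open>Free semigroup algebras\<close>

text \<open>
  Rows of operators are indexed by a finite set \<open>I\<close>; the free semigroup on \<open>I\<close> is the set
  \<^term>\<open>lists I\<close> of words with letters in \<open>I\<close>.
\<close>

definition row_isometry :: "'i set \<Rightarrow> ('i \<Rightarrow> 'a::complex_inner \<Rightarrow> 'a) \<Rightarrow> bool" where
  "row_isometry I V \<longleftrightarrow> (\<forall>i\<in>I. bounded_op (V i)) \<and>
     (\<forall>i\<in>I. \<forall>j\<in>I. adj (V i) \<circ> V j = (if i = j then id else (\<lambda>x. 0)))"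

definition free_semigroup_algebra :: "'i set \<Rightarrow> ('i \<Rightarrow> 'a::complex_inner \<Rightarrow> 'a) \<Rightarrow> ('a \<Rightarrow> 'a) set" where
  "free_semigroup_algebra I V = wot_alg (V ` I)"

text \<open>The left creation operator \<open>L\<^sub>i\<close>, mapping the basis vector of a word \<open>w\<close> to that of \<open>i # w\<close>.\<close>

lift_definition left_creation :: "'i \<Rightarrow> 'i list ell2 \<Rightarrow> 'i list ell2" is
  "\<lambda>i f w. case w of [] \<Rightarrow> 0 | j # v \<Rightarrow> if j = i then f v else 0"
proof -
  fix i :: 'i and f :: "'i list \<Rightarrow> complex"
  assume f: "(\<lambda>w. (cmod (f w))\<^sup>2) summable_on UNIV"
  let ?g = "\<lambda>w. (cmod (case w of [] \<Rightarrow> 0 | j # v \<Rightarrow> if j = i then f v else 0))\<^sup>2"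
  have "?g summable_on range ((#) i)"
    using f by (subst summable_on_reindex) (auto simp: o_def)
  then show "?g summable_on UNIV"
    by (rule summable_on_cong_neutral[THEN iffD1, rotated -1]) (auto split: list.splits)
qed

text \<open>\<open>\<ell>\<^sup>2\<close> of the free semigroup on \<open>I\<close>, as a subspace of \<open>\<ell>\<^sup>2\<close> of all words.\<close>

definition fock_space :: "'i set \<Rightarrow> 'i list ell2 set" where
  "fock_space I = {f. \<forall>w. w \<notin> lists I \<longrightarrow> Rep_ell2 f w = 0}"

definition left_regular_algebra :: "'i set \<Rightarrow> ('i list ell2 \<Rightarrow> 'i list ell2) set" where
  "left_regular_algebra I = wot_alg_on (fock_space I) (left_creation ` I)"

text \<open>
  The restriction of the free semigroup algebra of \<open>V\<close> to an invariant subspace \<open>K\<close>, i.e. the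
  free semigroup algebra on \<open>K\<close> generated by the restrictions of the \<open>V i\<close>, is analytic.
\<close>

definition analytic_on_subspace ::
    "'i set \<Rightarrow> ('i \<Rightarrow> 'a::complex_inner \<Rightarrow> 'a) \<Rightarrow> 'a set \<Rightarrow> bool" where
  "analytic_on_subspace I V K \<longleftrightarrow>
     (let \<TT> = wot_alg_on K (V ` I); \<LL> = left_regular_algebra I; F = proj (fock_space I) in
      \<exists>\<phi>. \<phi> ` \<TT> \<subseteq> \<LL> \<and> inj_on \<phi> \<TT> \<and>
        continuous_map (subtopology wot \<TT>) (subtopology wot \<LL>) \<phi> \<and>
        (\<forall>A\<in>\<TT>. \<forall>B\<in>\<TT>. \<phi> (\<lambda>x. A x + B x) = (\<lambda>\<xi>. \<phi> A \<xi> + \<phi> B \<xi>)) \<and>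
        (\<forall>c. \<forall>A\<in>\<TT>. \<phi> (\<lambda>x. c *\<^sub>C A x) = (\<lambda>\<xi>. c *\<^sub>C \<phi> A \<xi>)) \<and>
        (\<forall>A\<in>\<TT>. \<forall>B\<in>\<TT>. \<phi> (A \<circ> B) = \<phi> A \<circ> \<phi> B) \<and>
        \<phi> (proj K) = F \<and>
        (\<forall>i\<in>I. \<phi> (V i \<circ> proj K) = left_creation i \<circ> F))"

text \<open>
  The zero subspace is not analytic in the sense of the preceding definition, since nonzero
  generators are not images of \<open>0\<close>; it has to be admitted separately as the range of \<open>Q\<^sup>\<bottom>\<close>
  for the algebras without analytic part, whose structure projection is the identity.
\<close>

definition structure_projection ::
    "'i set \<Rightarrow> ('i \<Rightarrow> 'a::complex_inner \<Rightarrow> 'a) \<Rightarrow> ('a \<Rightarrow> 'a) \<Rightarrow> bool" where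
  "structure_projection I V Q \<longleftrightarrow>
     (let \<TT> = free_semigroup_algebra I V; \<NN> = vn_alg \<TT> in
      projection Q \<and> Q \<in> \<TT> \<and>
      self_adjoint_set {Q \<circ> A \<circ> Q | A. A \<in> \<TT>} \<and>
      {A \<circ> Q | A. A \<in> \<TT>} = {A \<circ> Q | A. A \<in> \<NN>} \<and>
      invariant_under \<TT> (range (perp Q)) \<and>
      (range (perp Q) = {0} \<or> analytic_on_subspace I V (range (perp Q))) \<and>
      (\<forall>K. invariant_under \<TT> K \<and> analytic_on_subspace I V K \<longrightarrow> K \<subseteq> range (perp Q)))"


section \<open>Single vertex 2-graphs\<close>

definition single_vertex_2graph :: "nat \<Rightarrow> nat \<Rightarrow> (nat \<times> nat \<Rightarrow> nat \<times> nat) \<Rightarrow> bool" where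
  "single_vertex_2graph m n \<theta> \<longleftrightarrow>
     0 < m \<and> 0 < n \<and> (1 < m \<or> 1 < n) \<and> \<theta> permutes ({1..m} \<times> {1..n})"

definition isometric_rep ::
    "nat \<Rightarrow> nat \<Rightarrow> (nat \<times> nat \<Rightarrow> nat \<times> nat) \<Rightarrow>
     (nat \<Rightarrow> 'a::complex_inner \<Rightarrow> 'a) \<Rightarrow> (nat \<Rightarrow> 'a \<Rightarrow> 'a) \<Rightarrow> bool" where
  "isometric_rep m n \<theta> S T \<longleftrightarrow> row_isometry {1..m} S \<and> row_isometry {1..n} T \<and>
     (\<forall>i\<in>{1..m}. \<forall>j\<in>{1..n}. \<forall>i' j'. \<theta> (i, j) = (i', j') \<longrightarrow> S i \<circ> T j = T j' \<circ> S i')"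

definition cuntz_type ::
    "nat \<Rightarrow> nat \<Rightarrow> (nat \<Rightarrow> 'a::complex_inner \<Rightarrow> 'a) \<Rightarrow> (nat \<Rightarrow> 'a \<Rightarrow> 'a) \<Rightarrow> bool" where
  "cuntz_type m n S T \<longleftrightarrow>
     (\<forall>x. (\<Sum>i\<in>{1..m}. S i (adj (S i) x)) = x) \<and> (\<forall>x. (\<Sum>j\<in>{1..n}. T j (adj (T j) x)) = x)"

definition two_graph_algebra ::
    "nat \<Rightarrow> nat \<Rightarrow> (nat \<Rightarrow> 'a::complex_inner \<Rightarrow> 'a) \<Rightarrow> (nat \<Rightarrow> 'a \<Rightarrow> 'a) \<Rightarrow> ('a \<Rightarrow> 'a) set" where
  "two_graph_algebra m n S T = wot_alg (S ` {1..m} \<union> T ` {1..n})"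

definition word_op :: "(nat \<Rightarrow> 'a \<Rightarrow> 'a) \<Rightarrow> nat list \<Rightarrow> 'a \<Rightarrow> 'a" where
  "word_op S u = foldr (\<lambda>i A. S i \<circ> A) u id"

text \<open>
  An element \<open>w = e\<^sub>u f\<^sub>v\<close> of the semigroup is represented by the pair \<open>(u, v)\<close> of its unique
  factorisation; its degree is the pair of lengths.
\<close>

definition words_of_degree :: "nat \<Rightarrow> nat \<Rightarrow> nat \<Rightarrow> nat \<Rightarrow> (nat list \<times> nat list) set" where
  "words_of_degree m n k l =
     {(u, v). u \<in> lists {1..m} \<and> v \<in> lists {1..n} \<and> length u = k \<and> length v = l}"

definition ST_op ::
    "(nat \<Rightarrow> 'a \<Rightarrow> 'a) \<Rightarrow> (nat \<Rightarrow> 'a \<Rightarrow> 'a) \<Rightarrow> nat list \<times> nat list \<Rightarrow> 'a \<Rightarrow> 'a" where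
  "ST_op S T = (\<lambda>(u, v). word_op S u \<circ> word_op T v)"

text \<open>
  \<open>P\<close> is the meet of the structure projections \<open>Q k l\<close>, which are unique because
  \<open>Q\<^sup>\<bottom>\<close> is the largest projection of its kind.
\<close>

definition first_structure_projection ::
    "nat \<Rightarrow> nat \<Rightarrow> (nat \<Rightarrow> 'a::complex_inner \<Rightarrow> 'a) \<Rightarrow> (nat \<Rightarrow> 'a \<Rightarrow> 'a) \<Rightarrow> ('a \<Rightarrow> 'a) \<Rightarrow> bool" where
  "first_structure_projection m n S T P \<longleftrightarrow>
     (\<exists>Q. (\<forall>k>0. \<forall>l>0. structure_projection (words_of_degree m n k l) (ST_op S T) (Q k l)) \<and>
          P = proj (\<Inter>k\<in>{0<..}. \<Inter>l\<in>{0<..}. range (Q k l)))"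

end

theory Submission
  imports Defs
begin

text \<open>
  Write \<open>\<AA>\<close> for \<open>\<SS>\<^sub>k\<^sub>,\<^sub>l\<close> and \<open>Q\<close> for its structure projection. As the row \<open>[(ST)\<^sub>w : d(w) = (k,l)]\<close> is of
  Cuntz type, a subset \<open>X\<close> of \<open>\<AA>\<close> stable under left multiplication by all \<open>(ST)\<^sub>w\<^sup>*\<close> with
  \<open>d(w) = (k,l)\<close> satisfies \<open>X = X Q\<close>: on the analytic part its elements are divisible by words of
  every length, hence vanish. The commutation relations make
  \<open>{S\<^sub>a\<^sup>* B Q S\<^sub>b : B \<in> W\<^sup>*(\<AA>)}\<close> such a set, so \<open>Q S\<^sub>b Q\<^sup>\<bottom> = 0\<close>, and likewise for the \<open>T\<^sub>j\<close>. Thus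
  \<open>Q\<^sup>\<bottom>\<close> is invariant under the whole algebra \<open>\<SS>\<close>. Moreover \<open>\<MM> Q \<subseteq> \<SS>\<close>, because \<open>Q\<close> lies in
  the largest subset of \<open>\<SS>\<close> stable under left multiplication by all \<open>S\<^sub>i\<^sup>*\<close> and \<open>T\<^sub>j\<^sup>*\<close>, which is a
  left ideal of \<open>\<MM>\<close>. The structure projections therefore belong to \<open>\<SS>\<close> and commute, so that
  their meet \<open>P\<close> is a strong limit of finite products and inherits both properties; the three
  claims follow from these.
\<close>


section \<open>Hilbert space preliminaries\<close>

lemma scaleC_zero_left [simp]: "0 *\<^sub>C (x::'a::complex_inner) = 0"
  using scaleC_add_left[of 0 0 x] by simp

lemma scaleC_zero_right [simp]: "c *\<^sub>C (0::'a::complex_inner) = 0"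
  using scaleC_add_right[of c 0 "0::'a"] by simp

lemma scaleC_one [simp]: "1 *\<^sub>C (x::'a::complex_inner) = x"
  using scaleR_scaleC[of 1 x] by simp

lemma scaleC_minus1: "(-1) *\<^sub>C (x::'a::complex_inner) = - x"
  using scaleR_scaleC[of "-1" x] by simp

lemma scaleC_minus_right: "c *\<^sub>C (- x) = - (c *\<^sub>C (x::'a::complex_inner))"
  using scaleC_add_right[of c x "-x"] by (simp add: add_eq_0_iff2)

lemma cinner_add_left: "cinner (x + y) z = cinner x z + cinner y (z::'a::complex_inner)"
  by (subst (1 2 3) cinner_commute) (simp add: cinner_add_right)

lemma cinner_scaleC_left: "cinner (c *\<^sub>C x) z = cnj c * cinner x (z::'a::complex_inner)"
  by (subst (1 2) cinner_commute) (simp add: cinner_scaleC_right)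

lemma cinner_zero_right [simp]: "cinner x (0::'a::complex_inner) = 0"
  using cinner_add_right[of x 0 0] by simp

lemma cinner_zero_left [simp]: "cinner 0 (x::'a::complex_inner) = 0"
  using cinner_add_left[of 0 0 x] by simp

lemma cinner_minus_right: "cinner x (- y) = - cinner x (y::'a::complex_inner)"
  using cinner_add_right[of x y "-y"] by (simp add: add_eq_0_iff2)

lemma cinner_diff_right: "cinner x (y - z) = cinner x y - cinner x (z::'a::complex_inner)"
  using cinner_add_right[of x y "-z"] by (simp add: cinner_minus_right)

text \<open>Conjugate linearity in the first argument makes the imaginary part a real inner product
  with \<open>\<i> *\<^sub>C x\<close>. Real statements applied to both \<open>x\<close> and
  \<open>\<i> *\<^sub>C x\<close> thus give complex ones.\<close>

lemma cinner_eq_Complex: "cinner x (y::'a::complex_inner) = Complex (inner x y) (inner (\<i> *\<^sub>C x) y)"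
  by (rule complex_eqI) (simp_all add: inner_eq_Re_cinner cinner_scaleC_left)

lemma cinner_eqI:
  assumes "\<And>x. cinner x (y::'a::complex_inner) = cinner x z"
  shows "y = z"
proof -
  have "inner (y - z) (y - z) = 0"
    using assms[of "y - z"] by (simp add: inner_eq_Re_cinner cinner_diff_right)
  then show ?thesis by simp
qed

lemma norm_scaleC: "norm (c *\<^sub>C (x::'a::complex_inner)) = cmod c * norm x"
proof -
  have "cnj c * c = of_real ((cmod c)\<^sup>2)"
    by (metis complex_norm_square mult.commute of_real_power)
  then have "cinner (c *\<^sub>C x) (c *\<^sub>C x) = of_real ((cmod c)\<^sup>2) * cinner x x"
    by (simp add: cinner_scaleC_left cinner_scaleC_right flip: mult.assoc) (simp add: mult.commute)
  then have "(norm (c *\<^sub>C x))\<^sup>2 = (cmod c * norm x)\<^sup>2"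
    by (simp add: power2_norm_eq_inner inner_eq_Re_cinner power_mult_distrib)
  then show ?thesis by simp
qed

lemma tendsto_cinner:
  assumes "(f \<longlongrightarrow> (a::'a::complex_inner)) F"
  shows "((\<lambda>t. cinner x (f t)) \<longlongrightarrow> cinner x a) F"
  unfolding cinner_eq_Complex by (intro tendsto_Complex tendsto_inner tendsto_const assms)

section \<open>Orthogonal projection and Riesz representation\<close>

lemma closed_csubspace_imp_subspace: "closed_csubspace K \<Longrightarrow> subspace K"
  unfolding closed_csubspace_def subspace_def by (simp add: scaleR_scaleC)

text \<open>A sequence in \<open>K\<close> minimising the distance to \<open>x\<close> is Cauchy by
  the parallelogram law; its limit \<open>y\<close> is a nearest point, and a first-order variation
  within \<open>K\<close> gives orthogonality.\<close>

lemma Hilbert_projection_exists: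
  fixes K :: "'a::{real_inner,complete_space} set"
  assumes K: "subspace K" "closed K"
  obtains y where "y \<in> K" "\<And>z. z \<in> K \<Longrightarrow> inner z (x - y) = 0"
proof -
  define D where "D = (\<lambda>z. (norm (x - z))\<^sup>2) ` K"
  define d where "d = Inf D"
  have bdd: "bdd_below D" unfolding D_def by (rule bdd_belowI2[of _ 0]) simp
  have ne: "D \<noteq> {}" using subspace_0[OF K(1)] by (auto simp: D_def)
  have dle: "d \<le> (norm (x - z))\<^sup>2" if "z \<in> K" for z
    unfolding d_def by (rule cInf_lower[OF _ bdd]) (use that in \<open>auto simp: D_def\<close>)
  have "\<exists>z\<in>K. (norm (x - z))\<^sup>2 < d + 1 / real (Suc n)" for n
  proof -
    have "Inf D < d + 1 / real (Suc n)" by (simp add: d_def)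
    from cInf_lessD[OF ne this] show ?thesis by (auto simp: D_def)
  qed
  then obtain s where sK: "\<And>n. s n \<in> K"
    and sd: "\<And>n. (norm (x - s n))\<^sup>2 < d + 1 / real (Suc n)" by metis
  \<comment> \<open>The midpoint of \<open>s i\<close> and \<open>s j\<close> lies in
    \<open>K\<close>, so its squared distance to \<open>x\<close> is at least \<open>d\<close>; the
    parallelogram identity then bounds the distance of the two points.\<close>
  have par: "(norm (s i - s j))\<^sup>2 \<le> 2 / real (Suc i) + 2 / real (Suc j)" for i j
  proof -
    have "(1/2) *\<^sub>R (s i + s j) \<in> K" using sK K(1) by (intro subspace_scale subspace_add)
    from dle[OF this] have "4 * d \<le> (norm (2 *\<^sub>R (x - (1/2) *\<^sub>R (s i + s j))))\<^sup>2"
      by (simp add: power_mult_distrib)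
    also have "2 *\<^sub>R (x - (1/2) *\<^sub>R (s i + s j)) = (x - s i) + (x - s j)"
      by (simp add: algebra_simps scaleR_2)
    finally have "4 * d \<le> (norm ((x - s i) + (x - s j)))\<^sup>2" .
    moreover have "(norm ((x - s i) + (x - s j)))\<^sup>2 + (norm ((x - s j) - (x - s i)))\<^sup>2 =
        2 * (norm (x - s i))\<^sup>2 + 2 * (norm (x - s j))\<^sup>2"
      by (simp add: power2_norm_eq_inner inner_diff_left inner_diff_right
          inner_add_left inner_add_right inner_commute)
    ultimately show ?thesis using sd[of i] sd[of j] by simp
  qed
  have "Cauchy s"
  proof (rule metric_CauchyI)
    fix e :: real assume e: "0 < e"
    obtain N where N: "1 / real (Suc N) < e\<^sup>2 / 4"
      using nat_approx_posE[of "e\<^sup>2/4"] e by auto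
    have "dist (s i) (s j) < e" if "N \<le> i" "N \<le> j" for i j
    proof -
      have "1 / real (Suc i) \<le> 1 / real (Suc N)" "1 / real (Suc j) \<le> 1 / real (Suc N)"
        using that by (simp_all add: frac_le)
      then have "(norm (s i - s j))\<^sup>2 < e\<^sup>2" using par[of i j] N by simp
      then show ?thesis using e by (simp add: dist_norm power2_less_imp_less)
    qed
    then show "\<exists>M. \<forall>m\<ge>M. \<forall>n\<ge>M. dist (s m) (s n) < e" by blast
  qed
  then obtain y where y: "s \<longlonglongrightarrow> y" using Cauchy_convergent convergent_def by blast
  have yK: "y \<in> K" using closed_sequentially[OF K(2)] sK y by blast
  have "(norm (x - y))\<^sup>2 \<le> d + 0"
  proof (rule LIMSEQ_le)
    show "(\<lambda>n. (norm (x - s n))\<^sup>2) \<longlonglongrightarrow> (norm (x - y))\<^sup>2" by (intro tendsto_intros y)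
    show "(\<lambda>n. d + 1 / real (Suc n)) \<longlonglongrightarrow> d + 0"
      by (intro tendsto_intros LIMSEQ_Suc[OF lim_1_over_n])
    show "\<exists>N. \<forall>n\<ge>N. (norm (x - s n))\<^sup>2 \<le> d + 1 / real (Suc n)" using sd less_imp_le by blast
  qed
  then have min: "(norm (x - y))\<^sup>2 \<le> (norm (x - z))\<^sup>2" if "z \<in> K" for z using dle[OF that] by linarith
  have "inner z (x - y) = 0" if z: "z \<in> K" for z
  proof (cases "z = 0")
    case False
    \<comment> \<open>This \<open>t\<close> minimises the quadratic polynomial
      \<open>t \<mapsto> (norm (x - y - t *\<^sub>R z))\<^sup>2\<close>.\<close>
    define t where "t = inner z (x - y) / inner z z"
    have "y + t *\<^sub>R z \<in> K" using K(1) yK z by (intro subspace_add subspace_scale)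
    from min[OF this] have "inner (x - y) (x - y) \<le> inner ((x - y) - t *\<^sub>R z) ((x - y) - t *\<^sub>R z)"
      by (simp add: power2_norm_eq_inner algebra_simps)
    also have "\<dots> = inner (x - y) (x - y) - 2 * t * inner z (x - y) + t * t * inner z z"
      by (simp add: inner_diff_left inner_diff_right inner_commute algebra_simps)
    also have "t * t * inner z z = t * inner z (x - y)" using False by (simp add: t_def)
    finally have "t * inner z (x - y) \<le> 0" by simp
    then have "inner z (x - y) * inner z (x - y) / inner z z \<le> 0" by (simp add: t_def)
    moreover have "0 < inner z z" using False by simp
    ultimately have "inner z (x - y) * inner z (x - y) \<le> 0" by (simp add: divide_le_0_iff)
    then show ?thesis by (auto simp: mult_le_0_iff)
  qed simp
  then show thesis using that yK by blast
qed

text \<open>The component \<open>e\<close> of a vector outside the kernel that is orthogonal to the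
  kernel spans its orthogonal complement; rescaling \<open>e\<close> represents
  \<open>f\<close>.\<close>

lemma Riesz_real:
  fixes f :: "'a::{real_inner,complete_space} \<Rightarrow> real"
  assumes "bounded_linear f"
  obtains y where "\<And>x. f x = inner x y"
proof (cases "\<forall>x. f x = 0")
  case True
  then show thesis using that[of 0] by simp
next
  case False
  then obtain x0 where x0: "f x0 \<noteq> 0" by blast
  interpret bounded_linear f by fact
  have "subspace {x. f x = 0}" by (simp add: subspace_def add scale zero)
  moreover have "closed {x. f x = 0}"
    by (intro closed_Collect_eq continuous_on continuous_on_const)
      (use isCont in \<open>simp add: continuous_at_imp_continuous_on continuous_on_id\<close>)
  ultimately obtain y0 where y0: "f y0 = 0" and orth: "\<And>z. f z = 0 \<Longrightarrow> inner z (x0 - y0) = 0"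
    using Hilbert_projection_exists[of "{x. f x = 0}" x0] by auto
  define e where "e = x0 - y0"
  have fe: "f e \<noteq> 0" using x0 y0 by (simp add: e_def diff)
  then have ee: "inner e e \<noteq> 0" using zero by auto
  have "f x = inner x ((f e / inner e e) *\<^sub>R e)" for x
  proof -
    have "f (x - (f x / f e) *\<^sub>R e) = 0" using fe by (simp add: diff scale)
    from orth[OF this] have "inner x e = f x / f e * inner e e"
      by (simp add: e_def[symmetric] inner_diff_left)
    then show ?thesis using fe ee by simp
  qed
  then show thesis using that by blast
qed

lemma proj_exists:
  fixes K :: "'a::chilbert_space set"
  assumes K: "closed_csubspace K"
  shows "\<exists>y. y \<in> K \<and> (\<forall>z\<in>K. cinner z (x - y) = 0)"
proof -
  obtain y where y: "y \<in> K" "\<And>z. z \<in> K \<Longrightarrow> inner z (x - y) = 0"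
    using Hilbert_projection_exists closed_csubspace_imp_subspace[OF K] K
    unfolding closed_csubspace_def by metis
  have "cinner z (x - y) = 0" if "z \<in> K" for z
    using y(2)[of z] y(2)[of "\<i> *\<^sub>C z"] K that
    by (simp add: cinner_eq_Complex closed_csubspace_def zero_complex.code)
  then show ?thesis using y(1) by blast
qed

lemma proj_eqI:
  fixes K :: "'a::complex_inner set"
  assumes K: "closed_csubspace K" and y: "y \<in> K" "\<And>z. z \<in> K \<Longrightarrow> cinner z (x - y) = 0"
  shows "proj K x = y"
  unfolding proj_def
proof (rule the_equality)
  show "y \<in> K \<and> (\<forall>z\<in>K. cinner z (x - y) = 0)" using y by blast
  fix y' assume y': "y' \<in> K \<and> (\<forall>z\<in>K. cinner z (x - y') = 0)"
  have "y' - y \<in> K"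
    using subspace_diff[OF closed_csubspace_imp_subspace[OF K]] y(1) y' by blast
  then have "cinner (y' - y) ((x - y) - (x - y')) = 0"
    using y y' by (simp add: cinner_diff_right)
  then have "inner (y' - y) (y' - y) = 0" by (simp add: inner_eq_Re_cinner)
  then show "y' = y" by simp
qed

lemma
  fixes K :: "'a::chilbert_space set"
  assumes K: "closed_csubspace K"
  shows proj_in: "proj K x \<in> K"
    and proj_orth: "z \<in> K \<Longrightarrow> cinner z (x - proj K x) = 0"
  using proj_exists[OF K, of x] proj_eqI[OF K] by metis+

lemma proj_id: "closed_csubspace K \<Longrightarrow> x \<in> K \<Longrightarrow> proj K x = (x::'a::complex_inner)"
  by (rule proj_eqI) simp_all

section \<open>Bounded operators and their adjoints\<close>

lemma bounded_opI:
  assumes "\<And>x y. A (x + y) = A x + A (y::'a::complex_inner)" "\<And>c x. A (c *\<^sub>C x) = c *\<^sub>C A x"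
    and "\<And>x. norm (A x) \<le> norm x * B"
  shows "bounded_op A"
  unfolding bounded_op_def using assms
  by (intro conjI bounded_linear_intro[where K = B] allI) (simp_all add: scaleR_scaleC)

lemma bounded_op_add: "bounded_op A \<Longrightarrow> A (x + y) = A x + A y"
  unfolding bounded_op_def by (simp add: bounded_linear.linear linear_add)
lemma bounded_op_diff: "bounded_op A \<Longrightarrow> A (x - y) = A x - A y"
  unfolding bounded_op_def by (simp add: bounded_linear.linear linear_diff)
lemma bounded_op_zero: "bounded_op A \<Longrightarrow> A 0 = 0"
  unfolding bounded_op_def by (simp add: bounded_linear.linear linear_0)
lemma bounded_op_sum: "bounded_op A \<Longrightarrow> A (sum f F) = (\<Sum>i\<in>F. A (f i))"
  unfolding bounded_op_def by (simp add: bounded_linear.linear linear_sum)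
lemma bounded_op_scaleC: "bounded_op A \<Longrightarrow> A (c *\<^sub>C x) = c *\<^sub>C A x"
  unfolding bounded_op_def by simp

lemma bounded_op_id [simp]: "bounded_op id"
  by (rule bounded_opI[where B = 1]) simp_all

lemma bounded_op_0 [simp]: "bounded_op (\<lambda>x. 0)"
  by (rule bounded_opI[where B = 1]) simp_all

lemma bounded_op_comp [intro]: "bounded_op A \<Longrightarrow> bounded_op B \<Longrightarrow> bounded_op (A \<circ> B)"
  unfolding bounded_op_def by (auto simp: o_def intro: bounded_linear_compose)

lemma bounded_op_plus [intro]: "bounded_op A \<Longrightarrow> bounded_op B \<Longrightarrow> bounded_op (\<lambda>x. A x + B x)"
  unfolding bounded_op_def by (auto simp: scaleC_add_right intro: bounded_linear_add)

lemma bounded_linear_scaleC: "bounded_linear (\<lambda>x::'a::complex_inner. c *\<^sub>C x)"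
  by (rule bounded_linear_intro[where K = "cmod c"])
    (simp_all add: scaleC_add_right scaleR_scaleC scaleC_scaleC mult.commute norm_scaleC)

lemma bounded_op_scale [intro]: "bounded_op A \<Longrightarrow> bounded_op (\<lambda>x. c *\<^sub>C A x)"
  unfolding bounded_op_def
  by (auto simp: scaleC_scaleC mult.commute intro: bounded_linear_compose[OF bounded_linear_scaleC])

lemma bounded_op_proj:
  fixes K :: "'a::chilbert_space set"
  assumes K: "closed_csubspace K"
  shows "bounded_op (proj K)"
proof (rule bounded_opI[where B = 1])
  note [simp] = proj_in[OF K]
  fix x y c
  show "proj K (x + y) = proj K x + proj K y"
  proof (rule proj_eqI[OF K])
    fix z assume "z \<in> K"
    then show "cinner z (x + y - (proj K x + proj K y)) = 0"
      using proj_orth[OF K, of z x] proj_orth[OF K, of z y]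
      by (simp add: cinner_diff_right cinner_add_right)
  qed (use K in \<open>simp add: closed_csubspace_def\<close>)
  show "proj K (c *\<^sub>C x) = c *\<^sub>C proj K x"
  proof (rule proj_eqI[OF K])
    fix z assume "z \<in> K"
    then show "cinner z (c *\<^sub>C x - c *\<^sub>C proj K x) = 0"
      using proj_orth[OF K, of z x] by (simp add: cinner_diff_right cinner_scaleC_right)
  qed (use K in \<open>simp add: closed_csubspace_def\<close>)
  have "inner (proj K x) (x - proj K x) = 0"
    using proj_orth[OF K, of "proj K x" x] by (simp add: inner_eq_Re_cinner)
  then have "norm (proj K x) * norm (proj K x) \<le> norm (proj K x) * norm x"
    using norm_cauchy_schwarz[of "proj K x" x]
    by (simp add: inner_diff_right power2_norm_eq_inner[symmetric] power2_eq_square)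
  then show "norm (proj K x) \<le> norm x * 1"
    by (metis mult.right_neutral mult_le_cancel_left_pos norm_ge_zero order_le_less)
qed

text \<open>Riesz representation of the real functional \<open>x \<mapsto> inner (A x) y\<close>;
  complex linearity of \<open>A\<close> recovers the imaginary part by replacing \<open>x\<close>
  with \<open>\<i> *\<^sub>C x\<close>.\<close>

lemma adj_exists:
  fixes A :: "'a::chilbert_space \<Rightarrow> 'a"
  assumes A: "bounded_op A"
  shows "\<exists>B. \<forall>x y. cinner (A x) y = cinner x (B y)"
proof -
  have "\<exists>b. \<forall>x. cinner (A x) y = cinner x b" for y
  proof -
    have "bounded_linear (\<lambda>x. inner (A x) y)"
      using A unfolding bounded_op_def
      by (auto intro: bounded_linear_compose[OF bounded_linear_inner_left])
    from Riesz_real[OF this] obtain b where b: "\<And>x. inner (A x) y = inner x b" by blast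
    have "cinner (A x) y = cinner x b" for x
      using b[of x] b[of "\<i> *\<^sub>C x"] by (simp add: cinner_eq_Complex bounded_op_scaleC[OF A])
    then show ?thesis by blast
  qed
  then show ?thesis by metis
qed

lemma adj_eqI:
  assumes "\<And>x y. cinner (A x) y = cinner x (B y)"
  shows "adj A = B"
  unfolding adj_def
proof (rule the_equality)
  show "\<forall>x y. cinner (A x) y = cinner x (B y)" using assms by blast
  fix B' assume "\<forall>x y. cinner (A x) y = cinner x (B' y)"
  then show "B' = B" using assms by (intro ext cinner_eqI) metis
qed

lemma cinner_adj_right:
  fixes A :: "'a::chilbert_space \<Rightarrow> 'a"
  assumes "bounded_op A"
  shows "cinner x (adj A y) = cinner (A x) y"
  using adj_exists[OF assms] adj_eqI by metis

lemma cinner_adj_left: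
  fixes A :: "'a::chilbert_space \<Rightarrow> 'a"
  assumes "bounded_op A"
  shows "cinner (adj A x) y = cinner x (A y)"
  using cinner_adj_right[OF assms, of y x] cinner_commute by metis

lemma bounded_op_adj [intro]:
  fixes A :: "'a::chilbert_space \<Rightarrow> 'a"
  assumes A: "bounded_op A"
  shows "bounded_op (adj A)"
proof -
  note [simp] = cinner_adj_right[OF A]
  obtain B where B: "\<And>x. norm (A x) \<le> norm x * B" "B \<ge> 0"
    using A unfolding bounded_op_def by (metis bounded_linear.nonneg_bounded)
  show ?thesis
  proof (rule bounded_opI[where B = B])
    fix x y c
    show "adj A (x + y) = adj A x + adj A y" by (rule cinner_eqI) (simp add: cinner_add_right)
    show "adj A (c *\<^sub>C x) = c *\<^sub>C adj A x" by (rule cinner_eqI) (simp add: cinner_scaleC_right)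
    have "norm (adj A x) * norm (adj A x) = inner (A (adj A x)) x"
      using cinner_adj_right[OF A, of "adj A x" x]
      by (metis inner_eq_Re_cinner power2_norm_eq_inner power2_eq_square)
    also have "\<dots> \<le> norm (A (adj A x)) * norm x" by (rule norm_cauchy_schwarz)
    also have "\<dots> \<le> norm (adj A x) * B * norm x" by (intro mult_right_mono B) simp
    finally have "norm (adj A x) * norm (adj A x) \<le> norm (adj A x) * (norm x * B)"
      by (simp add: mult_ac)
    then show "norm (adj A x) \<le> norm x * B"
      using B(2) by (cases "norm (adj A x) = 0") (simp_all add: mult_le_cancel_left)
  qed
qed

lemma adj_adj: "bounded_op A \<Longrightarrow> adj (adj A) = (A::'a::chilbert_space \<Rightarrow> 'a)"
  by (rule adj_eqI) (rule cinner_adj_left)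

lemma adj_comp:
  "bounded_op A \<Longrightarrow> bounded_op B \<Longrightarrow> adj (A \<circ> B) = adj B \<circ> adj (A::'a::chilbert_space \<Rightarrow> 'a)"
  by (rule adj_eqI) (simp add: cinner_adj_right)

lemma adj_plus:
  "bounded_op A \<Longrightarrow> bounded_op B \<Longrightarrow>
    adj (\<lambda>x. A x + B x) = (\<lambda>x. adj A x + adj (B::'a::chilbert_space \<Rightarrow> 'a) x)"
  by (rule adj_eqI) (simp add: cinner_adj_right cinner_add_left cinner_add_right)

lemma adj_scale:
  "bounded_op A \<Longrightarrow> adj (\<lambda>x. c *\<^sub>C A x) = (\<lambda>x. cnj c *\<^sub>C adj (A::'a::chilbert_space \<Rightarrow> 'a) x)"
  by (rule adj_eqI) (simp add: cinner_adj_right cinner_scaleC_left cinner_scaleC_right)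

lemma adj_id [simp]: "adj id = id"
  by (rule adj_eqI) simp

lemma adj_0 [simp]: "adj (\<lambda>x. 0) = (\<lambda>x. 0)"
  by (rule adj_eqI) simp


section \<open>The weak operator topology\<close>

lemma topspace_wot: "topspace wot = {A. bounded_op A}"
  by (simp add: wot_def topspace_pullback_topology)

lemma closedin_bounded_ops: "closedin wot {A. bounded_op A}"
  by (metis closedin_topspace topspace_wot)

lemma continuous_map_wot_cinner: "continuous_map wot euclidean (\<lambda>A. cinner x (A y))"
proof -
  have "continuous_map euclidean euclidean (\<lambda>h::'a \<times> 'a \<Rightarrow> complex. h (x, y))"
    by (simp add: continuous_on_product_coordinates)
  from continuous_map_pullback[OF this, of "{A. bounded_op A}" "\<lambda>A (x, y). cinner x (A y)"]
  show ?thesis unfolding wot_def by (simp add: o_def)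
qed

text \<open>The universal property of an initial topology: continuity is tested on the matrix
  coefficients.\<close>

lemma continuous_map_into_wot:
  assumes "\<And>x y. continuous_map X euclidean (\<lambda>a. cinner x (f a y))"
    and "\<And>a. a \<in> topspace X \<Longrightarrow> bounded_op (f a)"
  shows "continuous_map X wot f"
  unfolding wot_def
proof (rule continuous_map_pullback')
  show "continuous_map X euclidean ((\<lambda>A (x, y). cinner x (A y)) \<circ> f)"
    unfolding euclidean_product_topology[symmetric] continuous_map_componentwise_UNIV
    using assms(1) by (auto simp: o_def)
qed (use assms(2) in auto)

text \<open>The coefficient of \<open>C \<circ> A \<circ> D\<close> at \<open>x\<close>,
  \<open>y\<close> is that of \<open>A\<close> at \<open>adj C x\<close>, \<open>D y\<close>.
  Multiplication with one side or both sides fixed is therefore WOT-continuous, which is what the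
  closedness arguments below rest on.\<close>

lemma continuous_map_wot_sandwich:
  fixes C D :: "'a::chilbert_space \<Rightarrow> 'a"
  assumes "bounded_op C" "bounded_op D"
  shows "continuous_map wot wot (\<lambda>A. C \<circ> A \<circ> D)"
proof (rule continuous_map_into_wot)
  fix x y
  show "continuous_map wot euclidean (\<lambda>A. cinner x ((C \<circ> A \<circ> D) y))"
    using continuous_map_wot_cinner[of "adj C x" "D y"] by (simp add: cinner_adj_left assms)
qed (use assms in \<open>auto simp: topspace_wot\<close>)

lemma continuous_map_wot_right:
  "bounded_op (D::'a::chilbert_space \<Rightarrow> 'a) \<Longrightarrow> continuous_map wot wot (\<lambda>A. A \<circ> D)"
  using continuous_map_wot_sandwich[of id D] by simp

lemma continuous_map_wot_adj:
  "continuous_map wot wot (adj :: ('a::chilbert_space \<Rightarrow> 'a) \<Rightarrow> 'a \<Rightarrow> 'a)"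
proof (rule continuous_map_into_wot)
  fix x y :: 'a
  have "continuous_map wot euclidean (\<lambda>A. cnj (cinner y (A x)))"
    using continuous_map_compose[OF continuous_map_wot_cinner[of y x], of euclidean cnj]
    by (simp add: o_def continuous_on_cnj)
  moreover have "cnj (cinner y (A x)) = cinner x (adj A y)" if "A \<in> topspace wot" for A :: "'a \<Rightarrow> 'a"
    using that by (simp add: topspace_wot cinner_adj_right flip: cinner_commute)
  ultimately show "continuous_map wot euclidean (\<lambda>A. cinner x (adj A y))"
    by (rule continuous_map_eq)
qed (auto simp: topspace_wot)

text \<open>An intersection of closed preimages. The case of empty \<open>J\<close> is separate
  because the empty intersection would be the whole type and not \<open>Y\<close>.\<close>

lemma closedin_wot_Ball:
  assumes "closedin wot Y" "closedin wot X" "\<And>j. j \<in> J \<Longrightarrow> continuous_map wot wot (F j)"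
  shows "closedin wot {A \<in> Y. \<forall>j\<in>J. F j A \<in> X}"
proof (cases "J = {}")
  case False
  have "closedin wot (\<Inter>j\<in>J. {A \<in> Y. F j A \<in> X})"
    using False assms by (intro closedin_INT closedin_continuous_map_preimage_gen[of wot wot]) auto
  also have "(\<Inter>j\<in>J. {A \<in> Y. F j A \<in> X}) = {A \<in> Y. \<forall>j\<in>J. F j A \<in> X}" using False by auto
  finally show ?thesis .
qed (use assms in simp)

lemma closedin_wot_zero: "closedin wot {\<lambda>x::'a::complex_inner. 0::'a}"
proof -
  have "closedin wot {A \<in> {A. bounded_op A}. cinner x (A y) \<in> {0}}" for x y :: 'a
    by (rule closedin_continuous_map_preimage_gen[OF continuous_map_wot_cinner closedin_bounded_ops]) simp
  then have "closedin wot (\<Inter>p::'a \<times> 'a. {A \<in> {A. bounded_op A}. cinner (fst p) (A (snd p)) \<in> {0 :: complex}})"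
    by (intro closedin_INT) simp_all
  also have "(\<Inter>p::'a \<times> 'a. {A \<in> {A. bounded_op A}. cinner (fst p) (A (snd p)) \<in> {0}}) = {\<lambda>x::'a. 0::'a}"
  proof (intro equalityI subsetI)
    fix A assume "A \<in> (\<Inter>p::'a \<times> 'a. {A \<in> {A. bounded_op A}. cinner (fst p) (A (snd p)) \<in> {0}})"
    then have "cinner x (A y) = cinner x 0" for x y by (auto dest: spec[of _ "(x, y)"])
    then have "A y = 0" for y by (rule cinner_eqI)
    then show "A \<in> {\<lambda>x. 0}" by auto
  qed simp
  finally show ?thesis .
qed

text \<open>Strong convergence of a sequence implies weak convergence. This puts the meet of the
  structure projections into the algebra.\<close>

lemma closedin_wot_LIMSEQ:
  fixes f :: "nat \<Rightarrow> 'a::complex_inner \<Rightarrow> 'a"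
  assumes X: "closedin wot X" and f: "\<And>k. f k \<in> X" and A: "bounded_op A"
    and lim: "\<And>x. (\<lambda>k. f k x) \<longlonglongrightarrow> A x"
  shows "A \<in> X"
proof (rule ccontr)
  assume "A \<notin> X"
  have "openin wot (topspace wot - X)" using X by auto
  then obtain U :: "('a \<times> 'a \<Rightarrow> complex) set"
    where U: "open U" "topspace wot - X = (\<lambda>A (x, y). cinner x (A y)) -` U \<inter> {A. bounded_op A}"
    unfolding wot_def openin_pullback_topology by auto
  have "limitin (product_topology (\<lambda>_. euclidean) UNIV)
      (\<lambda>k (x, y). cinner x (f k y)) (\<lambda>(x, y). cinner x (A y)) sequentially"
    unfolding limitin_componentwise using lim by (auto intro!: tendsto_cinner)
  then have "((\<lambda>k (x, y). cinner x (f k y)) \<longlongrightarrow> (\<lambda>(x, y). cinner x (A y))) sequentially"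
    by (simp add: euclidean_product_topology)
  moreover have "(\<lambda>(x, y). cinner x (A y)) \<in> U"
    using U(2) A \<open>A \<notin> X\<close> by (auto simp: topspace_wot)
  ultimately have "eventually (\<lambda>k. (\<lambda>(x, y). cinner x (f k y)) \<in> U) sequentially"
    using U(1) topological_tendstoD by blast
  then obtain k where "(\<lambda>(x, y). cinner x (f k y)) \<in> U" by (auto simp: eventually_sequentially)
  moreover have "bounded_op (f k)" using f[of k] closedin_subset[OF X] by (auto simp: topspace_wot)
  ultimately have "f k \<in> topspace wot - X" unfolding U(2) by simp
  then show False using f by blast
qed


section \<open>WOT-closed algebras\<close>

definition wot_algebra :: "('a::complex_inner \<Rightarrow> 'a) set \<Rightarrow> bool" where
  "wot_algebra X \<longleftrightarrow> operator_algebra X \<and> closedin wot X \<and> id \<in> X"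

lemma operator_algebra_bounded: "operator_algebra X \<Longrightarrow> A \<in> X \<Longrightarrow> bounded_op A"
  and operator_algebra_zero: "operator_algebra X \<Longrightarrow> (\<lambda>x. 0) \<in> X"
  and operator_algebra_add: "operator_algebra X \<Longrightarrow> A \<in> X \<Longrightarrow> B \<in> X \<Longrightarrow> (\<lambda>x. A x + B x) \<in> X"
  and operator_algebra_scale: "operator_algebra X \<Longrightarrow> A \<in> X \<Longrightarrow> (\<lambda>x. c *\<^sub>C A x) \<in> X"
  and operator_algebra_comp: "operator_algebra X \<Longrightarrow> A \<in> X \<Longrightarrow> B \<in> X \<Longrightarrow> A \<circ> B \<in> X"
  unfolding operator_algebra_def by blast+

lemma operator_algebra_sum:
  assumes "operator_algebra X" "\<And>i. i \<in> I \<Longrightarrow> f i \<in> X"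
  shows "(\<lambda>x. \<Sum>i\<in>I. f i x) \<in> X"
  using assms(2)
  by (induction I rule: infinite_finite_induct)
    (simp_all add: operator_algebra_zero[OF assms(1)] operator_algebra_add[OF assms(1)])

lemma operator_algebra_perp:
  assumes "operator_algebra X" "id \<in> X" "A \<in> X"
  shows "perp A \<in> X"
proof -
  have "(\<lambda>x. id x + (-1) *\<^sub>C A x) \<in> X"
    using assms by (intro operator_algebra_add operator_algebra_scale)
  then show ?thesis by (simp add: perp_def scaleC_minus1)
qed

lemma wot_algebraD:
  assumes "wot_algebra X"
  shows "operator_algebra X" "closedin wot X" "id \<in> X"
  using assms by (auto simp: wot_algebra_def)

lemma operator_algebra_bounded_ops: "operator_algebra {A. bounded_op A}"
  unfolding operator_algebra_def by auto

lemma operator_algebra_Inter: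
  "\<F> \<noteq> {} \<Longrightarrow> (\<And>X. X \<in> \<F> \<Longrightarrow> operator_algebra X) \<Longrightarrow> operator_algebra (\<Inter>\<F>)"
  unfolding operator_algebra_def by blast

text \<open>The algebra of all bounded operators is one of the sets intersected, so the intersection
  is not the vacuous one.\<close>

lemma wot_algebra_wot_alg:
  assumes "\<And>A. A \<in> G \<Longrightarrow> bounded_op A"
  shows "wot_algebra (wot_alg G)"
proof -
  have "{A. bounded_op A} \<in> {X. operator_algebra X \<and> closedin wot X \<and> id \<in> X \<and> G \<subseteq> X}"
    using assms operator_algebra_bounded_ops closedin_bounded_ops by auto
  then have "operator_algebra (wot_alg G)" "closedin wot (wot_alg G)"
    unfolding wot_alg_def by (intro operator_algebra_Inter closedin_Inter; blast)+
  then show ?thesis unfolding wot_algebra_def by (auto simp: wot_alg_def)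
qed

lemma wot_alg_generator: "A \<in> G \<Longrightarrow> A \<in> wot_alg G"
  unfolding wot_alg_def by blast

lemma wot_alg_least: "wot_algebra X \<Longrightarrow> G \<subseteq> X \<Longrightarrow> wot_alg G \<subseteq> X"
  unfolding wot_alg_def wot_algebra_def by blast

lemma wot_algebra_vn_alg:
  fixes G :: "('a::chilbert_space \<Rightarrow> 'a) set"
  assumes "\<And>A. A \<in> G \<Longrightarrow> bounded_op A"
  shows "wot_algebra (vn_alg G)" "self_adjoint_set (vn_alg G)"
proof -
  have ne: "{A. bounded_op A} \<in>
      {X. operator_algebra X \<and> closedin wot X \<and> self_adjoint_set X \<and> id \<in> X \<and> G \<subseteq> X}"
    using assms operator_algebra_bounded_ops closedin_bounded_ops by (auto simp: self_adjoint_set_def)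
  then have "operator_algebra (vn_alg G)" "closedin wot (vn_alg G)"
    unfolding vn_alg_def by (intro operator_algebra_Inter closedin_Inter; blast)+
  then show "wot_algebra (vn_alg G)" unfolding wot_algebra_def by (auto simp: vn_alg_def)
  show "self_adjoint_set (vn_alg G)" unfolding vn_alg_def self_adjoint_set_def by blast
qed

lemma vn_alg_generator: "A \<in> G \<Longrightarrow> A \<in> vn_alg G"
  unfolding vn_alg_def by blast

lemma vn_alg_least: "wot_algebra X \<Longrightarrow> self_adjoint_set X \<Longrightarrow> G \<subseteq> X \<Longrightarrow> vn_alg G \<subseteq> X"
  unfolding vn_alg_def wot_algebra_def by blast

lemma wot_alg_on_props:
  fixes G :: "('a::chilbert_space \<Rightarrow> 'a) set"
  assumes "\<And>A. A \<in> G \<Longrightarrow> bounded_op A" "closed_csubspace K"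
  shows "operator_algebra (wot_alg_on K G)" "closedin wot (wot_alg_on K G)"
    "proj K \<in> wot_alg_on K G" "A \<in> G \<Longrightarrow> A \<circ> proj K \<in> wot_alg_on K G"
proof -
  have ne: "{A. bounded_op A} \<in> {X. operator_algebra X \<and> closedin wot X \<and> proj K \<in> X \<and>
     (\<lambda>A. A \<circ> proj K) ` G \<subseteq> X}"
    using assms operator_algebra_bounded_ops closedin_bounded_ops by (auto simp: bounded_op_proj)
  show "operator_algebra (wot_alg_on K G)" "closedin wot (wot_alg_on K G)"
    unfolding wot_alg_on_def using ne by (intro operator_algebra_Inter closedin_Inter; blast)+
qed (auto simp: wot_alg_on_def)

text \<open>The operators whose restriction lies in \<open>wot_alg_on K G\<close> form a WOT-closed
  algebra containing \<open>G\<close>. Invariance of \<open>K\<close> is what makes restriction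
  multiplicative.\<close>

lemma wot_alg_restrict:
  fixes G :: "('a::chilbert_space \<Rightarrow> 'a) set"
  assumes G: "\<And>A. A \<in> G \<Longrightarrow> bounded_op A" and K: "closed_csubspace K"
    and inv: "\<And>A. A \<in> wot_alg G \<Longrightarrow> A ` K \<subseteq> K" and A: "A \<in> wot_alg G"
  shows "A \<circ> proj K \<in> wot_alg_on K G"
proof -
  have wa: "operator_algebra (wot_alg G)" "closedin wot (wot_alg G)" "id \<in> wot_alg G"
    using wot_algebraD[of "wot_alg G"] wot_algebra_wot_alg[of G] G by blast+
  have R: "operator_algebra (wot_alg_on K G)" "closedin wot (wot_alg_on K G)"
    "proj K \<in> wot_alg_on K G" "\<And>A. A \<in> G \<Longrightarrow> A \<circ> proj K \<in> wot_alg_on K G"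
    using wot_alg_on_props[of G K] G K by blast+
  define Y where "Y = {A \<in> wot_alg G. A \<circ> proj K \<in> wot_alg_on K G}"
  have "operator_algebra Y" unfolding operator_algebra_def
  proof (intro conjI ballI allI)
    fix A B c assume A: "A \<in> Y" and B: "B \<in> Y"
    show "bounded_op A" using A wa by (auto simp: Y_def operator_algebra_bounded)
    show "(\<lambda>x. A x + B x) \<in> Y" "(\<lambda>x. c *\<^sub>C A x) \<in> Y"
      using A B operator_algebra_add[OF R(1), of "A \<circ> proj K" "B \<circ> proj K"]
        operator_algebra_scale[OF R(1), of "A \<circ> proj K" c]
      by (auto simp: Y_def o_def intro: operator_algebra_add[OF wa(1)] operator_algebra_scale[OF wa(1)])
    have "B (proj K x) \<in> K" for x using B inv proj_in[OF K] by (auto simp: Y_def)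
    then have "(A \<circ> B) \<circ> proj K = (A \<circ> proj K) \<circ> (B \<circ> proj K)"
      by (auto simp: fun_eq_iff proj_id[OF K])
    then show "A \<circ> B \<in> Y" using A B operator_algebra_comp[OF R(1)]
      by (auto simp: Y_def intro: operator_algebra_comp[OF wa(1)])
  qed (use wa R in \<open>auto simp: Y_def o_def operator_algebra_zero\<close>)
  moreover have "closedin wot Y" unfolding Y_def
    by (rule closedin_continuous_map_preimage_gen[OF continuous_map_wot_right[OF bounded_op_proj[OF K]] wa(2) R(2)])
  ultimately have "wot_algebra Y"
    using wa(3) R(3) by (simp add: wot_algebra_def Y_def)
  then have "wot_alg G \<subseteq> Y"
    by (rule wot_alg_least) (use R(4) in \<open>auto simp: Y_def wot_alg_generator\<close>)
  then show ?thesis using A by (auto simp: Y_def)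
qed


section \<open>Projections\<close>

lemma projectionD:
  fixes Q :: "'a::chilbert_space \<Rightarrow> 'a"
  assumes "projection Q"
  shows "bounded_op Q" "Q (Q x) = Q x" "cinner (Q x) y = cinner x (Q y)" "adj Q = Q"
proof -
  show b: "bounded_op Q" and a: "adj Q = Q" using assms by (auto simp: projection_def)
  show "Q (Q x) = Q x" using assms by (metis comp_apply projection_def)
  show "cinner (Q x) y = cinner x (Q y)" using cinner_adj_right[OF b] a by metis
qed

lemma range_projection:
  assumes "projection (Q::'a::chilbert_space \<Rightarrow> 'a)"
  shows "range Q = {x. Q x = x}"
  using projectionD(2)[OF assms] by auto (metis rangeI)

lemma range_perp:
  assumes "projection (Q::'a::chilbert_space \<Rightarrow> 'a)"
  shows "range (perp Q) = {x. Q x = 0}"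
proof -
  have "Q (perp Q x) = 0" for x
    using projectionD[OF assms] by (simp add: perp_def bounded_op_diff)
  moreover have "perp Q x = x" if "Q x = 0" for x using that by (simp add: perp_def)
  ultimately show ?thesis by (metis (mono_tags, lifting) mem_Collect_eq rangeI subsetI subset_antisym image_subset_iff)
qed

lemma closed_csubspace_Collect_eq:
  assumes "bounded_op A" "bounded_op (B::'a::complex_inner \<Rightarrow> 'a)"
  shows "closed_csubspace {x. A x = B x}"
proof -
  have "continuous_on UNIV A" "continuous_on UNIV B"
    using assms by (auto simp: bounded_op_def linear_continuous_on)
  then have "closed {x. A x = B x}" by (rule closed_Collect_eq)
  then show ?thesis using assms
    by (simp add: closed_csubspace_def bounded_op_zero bounded_op_add bounded_op_scaleC)
qed

lemma closed_csubspace_range_projection: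
  "projection Q \<Longrightarrow> closed_csubspace (range (Q::'a::chilbert_space \<Rightarrow> 'a))"
  using closed_csubspace_Collect_eq[of Q id] by (simp add: range_projection projectionD)

lemma closed_csubspace_range_perp:
  "projection Q \<Longrightarrow> closed_csubspace (range (perp (Q::'a::chilbert_space \<Rightarrow> 'a)))"
  using closed_csubspace_Collect_eq[of Q "\<lambda>x. 0"] by (simp add: range_perp projectionD)

lemma proj_range_perp:
  assumes "projection (Q::'a::chilbert_space \<Rightarrow> 'a)"
  shows "proj (range (perp Q)) = perp Q"
proof
  fix x
  show "proj (range (perp Q)) x = perp Q x"
  proof (rule proj_eqI[OF closed_csubspace_range_perp[OF assms]])
    fix z assume "z \<in> range (perp Q)"
    then have "Q z = 0" by (simp add: range_perp[OF assms])
    then show "cinner z (x - perp Q x) = 0"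
      by (simp add: perp_def flip: projectionD(3)[OF assms])
  qed simp
qed

lemma projection_proj:
  assumes K: "closed_csubspace (K::'a::chilbert_space set)"
  shows "projection (proj K)" "range (proj K) = K"
proof -
  have "proj K (proj K x) = proj K x" for x by (simp add: proj_id[OF K] proj_in[OF K])
  moreover have "adj (proj K) = proj K"
  proof (rule adj_eqI)
    fix x y
    have "cinner (proj K x) y = cinner (proj K x) (proj K y)"
      using proj_orth[OF K proj_in[OF K], of x y] by (simp add: cinner_diff_right)
    moreover have "cinner (proj K y) x = cinner (proj K y) (proj K x)"
      using proj_orth[OF K proj_in[OF K], of y x] by (simp add: cinner_diff_right)
    ultimately show "cinner (proj K x) y = cinner x (proj K y)" by (metis cinner_commute)
  qed
  ultimately show "projection (proj K)"
    by (simp add: projection_def bounded_op_proj[OF K] fun_eq_iff)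
  show "range (proj K) = K" using proj_in[OF K] proj_id[OF K] by (metis image_subsetI rangeI subsetI subset_antisym)
qed


section \<open>Row isometries of Cuntz type\<close>

text \<open>The row is a unitary from the direct sum of copies of the space onto the space. The
  resolution of the identity by the \<open>V i \<circ> adj (V i)\<close> is inserted repeatedly
  below.\<close>

definition cuntz_row :: "'i set \<Rightarrow> ('i \<Rightarrow> 'a::complex_inner \<Rightarrow> 'a) \<Rightarrow> bool" where
  "cuntz_row I V \<longleftrightarrow> finite I \<and> row_isometry I V \<and> (\<forall>x. (\<Sum>i\<in>I. V i (adj (V i) x)) = x)"

lemma cuntz_rowD:
  assumes "cuntz_row I V"
  shows "finite I" "i \<in> I \<Longrightarrow> bounded_op (V i)" "(\<Sum>i\<in>I. V i (adj (V i) x)) = x"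
    "i \<in> I \<Longrightarrow> j \<in> I \<Longrightarrow> adj (V i) \<circ> V j = (if i = j then id else (\<lambda>x. 0))"
    "i \<in> I \<Longrightarrow> j \<in> I \<Longrightarrow> adj (V i) (V j x) = (if i = j then x else 0)"
proof -
  show *: "i \<in> I \<Longrightarrow> j \<in> I \<Longrightarrow> adj (V i) \<circ> V j = (if i = j then id else (\<lambda>x. 0))"
    using assms unfolding cuntz_row_def row_isometry_def by blast
  show "i \<in> I \<Longrightarrow> j \<in> I \<Longrightarrow> adj (V i) (V j x) = (if i = j then x else 0)"
    using fun_cong[OF *, of x] by simp
qed (use assms in \<open>auto simp: cuntz_row_def row_isometry_def\<close>)

lemma cuntz_row_Times:
  fixes A :: "'i \<Rightarrow> 'a::chilbert_space \<Rightarrow> 'a"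
  assumes A: "cuntz_row I A" and B: "cuntz_row J B"
  shows "cuntz_row (I \<times> J) (\<lambda>(i, j). A i \<circ> B j)"
proof -
  note a = cuntz_rowD[OF A] and b = cuntz_rowD[OF B]
  have adj: "adj (A i \<circ> B j) = adj (B j) \<circ> adj (A i)" if "i \<in> I" "j \<in> J" for i j
    using that a b by (intro adj_comp)
  have "(\<Sum>(i, j)\<in>I \<times> J. A i (B j (adj (A i \<circ> B j) x))) = x" for x
  proof -
    have "(\<Sum>(i, j)\<in>I \<times> J. A i (B j (adj (A i \<circ> B j) x))) =
        (\<Sum>i\<in>I. \<Sum>j\<in>J. A i (B j (adj (B j) (adj (A i) x))))"
      by (simp add: sum.cartesian_product[symmetric] adj)
    also have "\<dots> = (\<Sum>i\<in>I. A i (\<Sum>j\<in>J. B j (adj (B j) (adj (A i) x))))"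
      by (simp add: bounded_op_sum[OF a(2)])
    also have "\<dots> = x" by (simp add: a b)
    finally show ?thesis .
  qed
  moreover have "adj (A i \<circ> B j) \<circ> (A i' \<circ> B j') = (if (i, j) = (i', j') then id else (\<lambda>x. 0))"
    if "i \<in> I" "j \<in> J" "i' \<in> I" "j' \<in> J" for i j i' j'
    using that by (auto simp: fun_eq_iff adj a(5) b(5) bounded_op_zero[OF bounded_op_adj[OF b(2)]])
  ultimately show ?thesis
    using a b by (auto simp: cuntz_row_def row_isometry_def case_prod_unfold)
qed

lemma cuntz_row_image:
  assumes "inj_on f J" "cuntz_row J (\<lambda>j. V (f j))"
  shows "cuntz_row (f ` J) V"
  using assms unfolding cuntz_row_def row_isometry_def
  by (auto simp: sum.reindex inj_on_eq_iff)

section \<open>Words in a Cuntz family\<close>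

lemma word_op_Nil [simp]: "word_op S [] = id"
  and word_op_Cons [simp]: "word_op S (i # u) = S i \<circ> word_op S u"
  by (simp_all add: word_op_def)

lemma word_op_append: "word_op S (u @ v) = word_op S u \<circ> word_op S v"
  by (induction u) (simp_all add: o_assoc)

lemma cuntz_row_words:
  fixes S :: "nat \<Rightarrow> 'a::chilbert_space \<Rightarrow> 'a"
  assumes "cuntz_row I S"
  shows "cuntz_row {u \<in> lists I. length u = k} (word_op S)"
proof (induction k)
  case 0
  have "{u \<in> lists I. length u = 0} = {[]}" by auto
  then show ?case by (simp add: cuntz_row_def row_isometry_def)
next
  case (Suc k)
  have "cuntz_row ((\<lambda>(i, u). i # u) ` (I \<times> {u \<in> lists I. length u = k})) (word_op S)"
    using cuntz_row_Times[OF assms Suc]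
    by (intro cuntz_row_image) (auto simp: inj_on_def case_prod_unfold)
  also have "(\<lambda>(i, u). i # u) ` (I \<times> {u \<in> lists I. length u = k}) = {u \<in> lists I. length u = Suc k}"
    by (force simp: length_Suc_conv)
  finally show ?case .
qed


section \<open>The ideal determined by the structure projection\<close>

lemma Rep_ell2_sum: "Rep_ell2 (sum f F) w = (\<Sum>i\<in>F. Rep_ell2 (f i) w)"
  by (induction F rule: infinite_finite_induct) (simp_all add: zero_ell2.rep_eq plus_ell2.rep_eq)

text \<open>
  The analytic part of an element of \<open>X\<close> is divisible by words of every length; its image in
  the algebra of the left regular representation therefore has no Fourier coefficients.
\<close>

lemma structure_projection_absorbs:
  fixes V :: "'i \<Rightarrow> 'a::chilbert_space \<Rightarrow> 'a"
  assumes V: "cuntz_row I V" and Q: "structure_projection I V Q"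
    and X: "X \<subseteq> free_semigroup_algebra I V" "\<And>A i. A \<in> X \<Longrightarrow> i \<in> I \<Longrightarrow> adj (V i) \<circ> A \<in> X"
    and A: "A \<in> X"
  shows "A \<circ> Q = A"
proof -
  define K where "K = range (perp Q)"
  define TT where "TT = wot_alg_on K (V ` I)"
  note v = cuntz_rowD[OF V]
  have prQ: "projection Q"
    and inv: "invariant_under (free_semigroup_algebra I V) K"
    and an: "K = {0} \<or> analytic_on_subspace I V K"
    using Q unfolding structure_projection_def Let_def K_def by blast+
  have K: "closed_csubspace K" using inv by (simp add: invariant_under_def)
  have pK: "proj K = perp Q" unfolding K_def by (rule proj_range_perp[OF prQ])
  have bV: "bounded_op B" if "B \<in> V ` I" for B using that v(2) by blast
  have fsa: "wot_algebra (free_semigroup_algebra I V)"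
    unfolding free_semigroup_algebra_def by (rule wot_algebra_wot_alg[OF bV])
  have XB: "bounded_op B" if "B \<in> X" for B
    using that X(1) fsa by (auto simp: wot_algebra_def intro: operator_algebra_bounded)
  have TT: "operator_algebra TT" "proj K \<in> TT" "\<And>i. i \<in> I \<Longrightarrow> V i \<circ> proj K \<in> TT"
    using wot_alg_on_props[OF bV K] by (auto simp: TT_def)
  have XT: "B \<circ> proj K \<in> TT" if "B \<in> X" for B
    unfolding TT_def
    by (rule wot_alg_restrict[OF bV K])
      (use inv X(1) that in \<open>auto simp: invariant_under_def free_semigroup_algebra_def\<close>)
  have XK: "B x \<in> K" if "B \<in> X" "x \<in> K" for B x
    using that X(1) inv by (auto simp: invariant_under_def)
  \<comment> \<open>Since \<open>A\<close> is the sum of \<open>A \<circ> Q\<close> and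
    \<open>A \<circ> perp Q\<close>, and \<open>proj K = perp Q\<close>, the claim amounts to
    \<open>A\<close> vanishing on \<open>K\<close>.\<close>
  have "A \<circ> proj K = (\<lambda>x. 0)"
    using an
  proof
    assume "K = {0}"
    then have "proj K x = 0" for x using proj_in[OF K] by blast
    then show ?thesis using XB[OF A] by (auto simp: bounded_op_zero)
  next
    define F where "F = proj (fock_space I)"
    assume "analytic_on_subspace I V K"
    then obtain \<phi> where inj: "inj_on \<phi> TT"
      and "\<forall>A\<in>TT. \<forall>B\<in>TT. \<phi> (\<lambda>x. A x + B x) = (\<lambda>\<xi>. \<phi> A \<xi> + \<phi> B \<xi>)"
      and "\<forall>c. \<forall>A\<in>TT. \<phi> (\<lambda>x. c *\<^sub>C A x) = (\<lambda>\<xi>. c *\<^sub>C \<phi> A \<xi>)"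
      and "\<forall>A\<in>TT. \<forall>B\<in>TT. \<phi> (A \<circ> B) = \<phi> A \<circ> \<phi> B"
      and one: "\<phi> (proj K) = F"
      and "\<forall>i\<in>I. \<phi> (V i \<circ> proj K) = left_creation i \<circ> F"
      unfolding analytic_on_subspace_def Let_def TT_def[symmetric] F_def[symmetric]
      by (elim exE conjE) (rule that; assumption)
    then have add: "\<And>A B. A \<in> TT \<Longrightarrow> B \<in> TT \<Longrightarrow> \<phi> (\<lambda>x. A x + B x) = (\<lambda>\<xi>. \<phi> A \<xi> + \<phi> B \<xi>)"
      and scale: "\<And>c A. A \<in> TT \<Longrightarrow> \<phi> (\<lambda>x. c *\<^sub>C A x) = (\<lambda>\<xi>. c *\<^sub>C \<phi> A \<xi>)"
      and comp: "\<And>A B. A \<in> TT \<Longrightarrow> B \<in> TT \<Longrightarrow> \<phi> (A \<circ> B) = \<phi> A \<circ> \<phi> B"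
      and gen: "\<And>i. i \<in> I \<Longrightarrow> \<phi> (V i \<circ> proj K) = left_creation i \<circ> F"
      by simp_all
    have zero: "\<phi> (\<lambda>x. 0) = (\<lambda>\<xi>. 0)" using scale[OF TT(2), of 0] by simp
    have sum: "\<phi> (\<lambda>x. \<Sum>i\<in>J. G i x) = (\<lambda>\<xi>. \<Sum>i\<in>J. \<phi> (G i) \<xi>)"
      if "finite J" "\<And>i. i \<in> J \<Longrightarrow> G i \<in> TT" for J :: "'i set" and G
      using that by (induction J rule: finite_induct)
        (simp_all add: zero add operator_algebra_sum[OF TT(1)])
    \<comment> \<open>Insert the identity as the sum of the \<open>V i \<circ> adj (V i)\<close> to
      the left of \<open>B\<close>. Each \<open>adj (V i) \<circ> B\<close> is again in
      \<open>X\<close>, hence maps \<open>K\<close> into itself, so the factorisation restricts to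
      \<open>K\<close> and \<phi> may be applied factor by factor.\<close>
    have step: "\<phi> (B \<circ> proj K) = (\<lambda>\<xi>. \<Sum>i\<in>I. left_creation i (\<phi> (adj (V i) \<circ> B \<circ> proj K) \<xi>))"
      if B: "B \<in> X" for B
    proof -
      let ?C = "\<lambda>i. adj (V i) \<circ> B \<circ> proj K"
      have C: "?C i \<in> TT" and fixC: "proj K \<circ> ?C i = ?C i" if "i \<in> I" for i
      proof -
        have "adj (V i) (B (proj K x)) \<in> K" for x
          using XK[OF X(2)[OF B that] proj_in[OF K]] by simp
        then show "proj K \<circ> ?C i = ?C i" by (auto simp: proj_id[OF K])
      qed (use XT[OF X(2)[OF B that]] in simp)
      have "B \<circ> proj K = (\<lambda>x. \<Sum>i\<in>I. ((V i \<circ> proj K) \<circ> ?C i) x)"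
      proof
        fix x
        have "(\<Sum>i\<in>I. ((V i \<circ> proj K) \<circ> ?C i) x) = (\<Sum>i\<in>I. V i (adj (V i) (B (proj K x))))"
          using fixC by (intro sum.cong refl) (metis comp_apply)
        then show "(B \<circ> proj K) x = (\<Sum>i\<in>I. ((V i \<circ> proj K) \<circ> ?C i) x)" by (simp add: v(3))
      qed
      then have "\<phi> (B \<circ> proj K) = \<phi> (\<lambda>x. \<Sum>i\<in>I. ((V i \<circ> proj K) \<circ> ?C i) x)" by (rule arg_cong)
      also have "\<dots> = (\<lambda>\<xi>. \<Sum>i\<in>I. \<phi> ((V i \<circ> proj K) \<circ> ?C i) \<xi>)"
        by (rule sum[OF v(1)]) (intro operator_algebra_comp[OF TT(1)] TT C)
      also have "\<dots> = (\<lambda>\<xi>. \<Sum>i\<in>I. left_creation i (\<phi> (?C i) \<xi>))"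
      proof (intro ext sum.cong refl)
        fix \<xi> i assume i: "i \<in> I"
        have "\<phi> ((V i \<circ> proj K) \<circ> ?C i) = (left_creation i \<circ> F) \<circ> \<phi> (?C i)"
          using comp[OF TT(3)[OF i] C[OF i]] gen[OF i] by simp
        also have "\<dots> = left_creation i \<circ> \<phi> (proj K \<circ> ?C i)"
          using comp[OF TT(2) C[OF i]] one by (simp add: o_assoc)
        finally show "\<phi> ((V i \<circ> proj K) \<circ> ?C i) \<xi> = left_creation i (\<phi> (?C i) \<xi>)"
          by (simp add: fixC[OF i])
      qed
      finally show ?thesis .
    qed
    \<comment> \<open>Induction on the word: a left creation has coefficient 0 at the empty word,
      and its coefficient at \<open>a # w\<close> is 0 or a coefficient at \<open>w\<close> of the
      image of another element of \<open>X\<close>.\<close>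
    have coeff: "Rep_ell2 (\<phi> (B \<circ> proj K) \<xi>) w = 0" if "B \<in> X" for B \<xi> w
      using that
    proof (induction w arbitrary: B)
      case Nil
      show ?case unfolding step[OF Nil] by (simp add: Rep_ell2_sum left_creation.rep_eq)
    next
      case (Cons a w)
      have "Rep_ell2 (\<phi> (adj (V i) \<circ> B \<circ> proj K) \<xi>) w = 0" if "i \<in> I" for i
        by (rule Cons.IH[OF X(2)[OF Cons.prems that]])
      then show ?case unfolding step[OF Cons.prems]
        by (simp add: Rep_ell2_sum left_creation.rep_eq sum.neutral)
    qed
    have "\<phi> (A \<circ> proj K) \<xi> = 0" for \<xi>
      using coeff[OF A, of \<xi>] by (metis Rep_ell2_inject ext zero_ell2.rep_eq)
    then have "\<phi> (A \<circ> proj K) = \<phi> (\<lambda>x. 0)" by (simp add: zero fun_eq_iff)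
    with inj show ?thesis using XT[OF A] operator_algebra_zero[OF TT(1)] by (rule inj_onD)
  qed
  then have "A (perp Q x) = 0" for x by (metis comp_apply pK)
  then show ?thesis by (auto simp: fun_eq_iff perp_def bounded_op_diff[OF XB[OF A]])
qed

text \<open>The defining equality of left multiples of \<open>Q\<close> replaces \<open>B\<close> by
  an element of the free semigroup algebra, which also contains \<open>Q\<close>.\<close>

lemma structure_projection_left_ideal:
  fixes V :: "'i \<Rightarrow> 'a::chilbert_space \<Rightarrow> 'a"
  assumes "\<And>i. i \<in> I \<Longrightarrow> bounded_op (V i)" and Q: "structure_projection I V Q"
    and B: "B \<in> vn_alg (free_semigroup_algebra I V)"
  shows "B \<circ> Q \<in> free_semigroup_algebra I V"
proof -
  have fsa: "wot_algebra (free_semigroup_algebra I V)"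
    unfolding free_semigroup_algebra_def by (rule wot_algebra_wot_alg) (use assms(1) in blast)
  have "B \<circ> Q \<in> {A \<circ> Q |A. A \<in> free_semigroup_algebra I V}" and "Q \<in> free_semigroup_algebra I V"
    using Q B unfolding structure_projection_def Let_def by blast+
  then show ?thesis using operator_algebra_comp[OF wot_algebraD(1)[OF fsa]] by auto
qed

text \<open>The operators \<open>adj (R c) \<circ> B \<circ> Q \<circ> R b\<close>, with
  \<open>B\<close> in the von Neumann algebra, lie in the free semigroup algebra and are stable
  under left multiplication by every \<open>adj (V i)\<close>, so each of them absorbs
  \<open>Q\<close> on the right. For \<open>B = id\<close>, summation over \<open>c\<close> gives
  \<open>Q \<circ> R b \<circ> Q = Q \<circ> R b\<close>.\<close>

lemma structure_projection_perp_invariant: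
  fixes V :: "'i \<Rightarrow> 'a::chilbert_space \<Rightarrow> 'a" and R :: "'j \<Rightarrow> 'a \<Rightarrow> 'a"
  assumes V: "cuntz_row I V" and R: "cuntz_row E R" and Q: "structure_projection I V Q"
    and VR: "\<And>i b. i \<in> I \<Longrightarrow> b \<in> E \<Longrightarrow> \<exists>a\<in>E. \<exists>j\<in>I. V i \<circ> R b = R a \<circ> V j"
    and RV: "\<And>i b. i \<in> I \<Longrightarrow> b \<in> E \<Longrightarrow> \<exists>a\<in>E. \<exists>j\<in>I. R b \<circ> V i = V j \<circ> R a"
    and b: "b \<in> E" and x: "Q x = 0"
  shows "Q (R b x) = 0"
proof -
  define TT where "TT = free_semigroup_algebra I V"
  note v = cuntz_rowD[OF V] and r = cuntz_rowD[OF R]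
  have bV: "bounded_op B" if "B \<in> V ` I" for B using that v(2) by blast
  have TT: "operator_algebra TT" "closedin wot TT" "id \<in> TT"
    using wot_algebraD[OF wot_algebra_wot_alg[OF bV]] by (auto simp: TT_def free_semigroup_algebra_def)
  have VT: "V i \<in> TT" if "i \<in> I" for i
    using that by (simp add: TT_def free_semigroup_algebra_def wot_alg_generator)
  have bTT: "bounded_op A" if "A \<in> TT" for A using operator_algebra_bounded[OF TT(1) that] .
  have vn: "wot_algebra (vn_alg TT)" "self_adjoint_set (vn_alg TT)"
    using wot_algebra_vn_alg[of TT] bTT by blast+
  \<comment> \<open>The elements all of whose compressions stay in \<open>TT\<close> are shown to
    form a WOT-closed algebra containing the generators.\<close>
  have compress: "adj (R c) \<circ> A \<circ> R b \<in> TT" if "A \<in> TT" "b \<in> E" "c \<in> E" for A b c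
  proof -
    define Y where "Y = {A \<in> TT. \<forall>(b, c)\<in>E \<times> E. adj (R c) \<circ> A \<circ> R b \<in> TT}"
    have delta: "adj (R c) \<circ> R a \<circ> B \<in> TT" if "B \<in> TT" "a \<in> E" "c \<in> E" for B a c
      using that TT r(4)[of c a] by (auto simp: o_def operator_algebra_zero)
    have YI: "A \<in> Y" if "A \<in> TT" "\<And>b c. b \<in> E \<Longrightarrow> c \<in> E \<Longrightarrow> adj (R c) \<circ> A \<circ> R b \<in> TT" for A
      using that by (auto simp: Y_def)
    have YD: "adj (R c) \<circ> A \<circ> R b \<in> TT" if "A \<in> Y" "b \<in> E" "c \<in> E" for A b c
      using that by (auto simp: Y_def)
    have "operator_algebra Y" unfolding operator_algebra_def
    proof (intro conjI ballI allI)
      fix A B k assume A: "A \<in> Y" and B: "B \<in> Y"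
      show "bounded_op A" using A bTT by (auto simp: Y_def)
      show "(\<lambda>x. A x + B x) \<in> Y"
      proof (rule YI)
        fix b c assume bc: "b \<in> E" "c \<in> E"
        have "adj (R c) \<circ> (\<lambda>x. A x + B x) \<circ> R b =
            (\<lambda>x. (adj (R c) \<circ> A \<circ> R b) x + (adj (R c) \<circ> B \<circ> R b) x)"
          using bc r(2) by (auto simp: bounded_op_add[OF bounded_op_adj])
        then show "adj (R c) \<circ> (\<lambda>x. A x + B x) \<circ> R b \<in> TT"
          using operator_algebra_add[OF TT(1) YD[OF A bc] YD[OF B bc]] by metis
      qed (use A B in \<open>auto simp: Y_def intro: operator_algebra_add[OF TT(1)]\<close>)
      show "(\<lambda>x. k *\<^sub>C A x) \<in> Y"
      proof (rule YI)
        fix b c assume bc: "b \<in> E" "c \<in> E"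
        have "adj (R c) \<circ> (\<lambda>x. k *\<^sub>C A x) \<circ> R b = (\<lambda>x. k *\<^sub>C (adj (R c) \<circ> A \<circ> R b) x)"
          using bc r(2) by (auto simp: bounded_op_scaleC[OF bounded_op_adj])
        then show "adj (R c) \<circ> (\<lambda>x. k *\<^sub>C A x) \<circ> R b \<in> TT"
          using operator_algebra_scale[OF TT(1) YD[OF A bc]] by metis
      qed (use A in \<open>auto simp: Y_def intro: operator_algebra_scale[OF TT(1)]\<close>)
      show "A \<circ> B \<in> Y"
      proof (rule YI)
        fix b c assume bc: "b \<in> E" "c \<in> E"
        have bA: "bounded_op (adj (R c) \<circ> A)"
          using A bTT bc r(2) by (auto simp: Y_def)
        \<comment> \<open>The resolution of the identity by the row \<open>R\<close>, inserted
          between \<open>A\<close> and \<open>B\<close>, turns the compression of a product into a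
          matrix product of compressions.\<close>
        have "(adj (R c) \<circ> (A \<circ> B) \<circ> R b) x =
            (\<Sum>a\<in>E. ((adj (R c) \<circ> A \<circ> R a) \<circ> (adj (R a) \<circ> B \<circ> R b)) x)" for x
          using bounded_op_sum[OF bA, of "\<lambda>a. R a (adj (R a) (B (R b x)))" E] by (simp add: r(3))
        then have *: "adj (R c) \<circ> (A \<circ> B) \<circ> R b =
            (\<lambda>x. \<Sum>a\<in>E. ((adj (R c) \<circ> A \<circ> R a) \<circ> (adj (R a) \<circ> B \<circ> R b)) x)" by blast
        show "adj (R c) \<circ> (A \<circ> B) \<circ> R b \<in> TT" unfolding *
          by (intro operator_algebra_sum operator_algebra_comp TT YD A B bc)
      qed (use A B in \<open>auto simp: Y_def intro: operator_algebra_comp[OF TT(1)]\<close>)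
    next
      show "(\<lambda>x. 0) \<in> Y"
        using r(2) by (intro YI) (auto simp: o_def operator_algebra_zero[OF TT(1)] bounded_op_zero[OF bounded_op_adj])
    qed
    moreover have "closedin wot Y"
      unfolding Y_def case_prod_unfold
      by (intro closedin_wot_Ball TT continuous_map_wot_sandwich) (auto intro!: bounded_op_adj r(2))
    moreover have "id \<in> Y" using delta[OF TT(3)] TT by (auto intro: YI)
    moreover have "V ` I \<subseteq> Y"
    proof
      fix B assume "B \<in> V ` I"
      then obtain i where i: "i \<in> I" "B = V i" by blast
      show "B \<in> Y"
      proof (rule YI)
        fix b c assume bc: "b \<in> E" "c \<in> E"
        obtain a j where aj: "a \<in> E" "j \<in> I" "V i \<circ> R b = R a \<circ> V j" using VR[OF i(1) bc(1)] by blast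
        \<comment> \<open>Once \<open>V i\<close> has passed \<open>R b\<close>, the product
          \<open>adj (R c) \<circ> R a\<close> is the identity or 0, so the compression is
          \<open>V j\<close> or 0.\<close>
        have "adj (R c) \<circ> V i \<circ> R b = adj (R c) \<circ> R a \<circ> V j" by (simp add: comp_assoc aj(3))
        then show "adj (R c) \<circ> B \<circ> R b \<in> TT" using delta[OF VT[OF aj(2)] aj(1) bc(2)] i by simp
      qed (use i VT in simp)
    qed
    ultimately have "TT \<subseteq> Y"
      unfolding TT_def free_semigroup_algebra_def by (intro wot_alg_least) (auto simp: wot_algebra_def)
    then show ?thesis using that by (auto simp: Y_def)
  qed
  define X where "X = {adj (R c) \<circ> (B \<circ> Q) \<circ> R b |B b c. B \<in> vn_alg TT \<and> b \<in> E \<and> c \<in> E}"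
  have XT: "X \<subseteq> TT"
    using structure_projection_left_ideal[OF v(2) Q] compress by (auto simp: X_def TT_def)
  have XV: "adj (V i) \<circ> A \<in> X" if A: "A \<in> X" and i: "i \<in> I" for A i
  proof -
    obtain B b c where B: "B \<in> vn_alg TT" "b \<in> E" "c \<in> E" "A = adj (R c) \<circ> (B \<circ> Q) \<circ> R b"
      using A by (auto simp: X_def)
    obtain a j where aj: "a \<in> E" "j \<in> I" "R c \<circ> V i = V j \<circ> R a" using RV[OF i B(3)] by blast
    have *: "adj (V i) \<circ> adj (R c) = adj (R a) \<circ> adj (V j)"
      using adj_comp[of "R c" "V i"] adj_comp[of "V j" "R a"] aj i B v(2) r(2) by metis
    have "adj (V i) \<circ> A = adj (R a) \<circ> ((adj (V j) \<circ> B) \<circ> Q) \<circ> R b"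
      unfolding B(4) by (simp add: o_assoc *)
    moreover have "adj (V j) \<circ> B \<in> vn_alg TT"
      using vn vn_alg_generator[OF VT[OF aj(2)]] B(1)
      by (auto simp: self_adjoint_set_def wot_algebra_def intro: operator_algebra_comp)
    ultimately show ?thesis using aj(1) B(2) by (auto simp: X_def)
  qed
  have Qx: "adj (R c) (Q (R b x)) = 0" if "c \<in> E" for c
  proof -
    have "adj (R c) \<circ> (id \<circ> Q) \<circ> R b \<in> X"
      using that b wot_algebraD(3)[OF vn(1)] unfolding X_def by blast
    from structure_projection_absorbs[OF V Q XT[unfolded TT_def] XV this]
    have "adj (R c) (Q (R b (Q x))) = adj (R c) (Q (R b x))" by (metis comp_apply id_comp)
    moreover have "bounded_op Q" using Q by (simp add: structure_projection_def Let_def projection_def)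
    ultimately show ?thesis using that b r(2) x by (simp add: bounded_op_zero bounded_op_adj)
  qed
  have "Q (R b x) = (\<Sum>c\<in>E. R c (adj (R c) (Q (R b x))))" by (rule r(3)[symmetric])
  also have "\<dots> = 0" using r(2) by (auto simp: Qx bounded_op_zero intro!: sum.neutral)
  finally show ?thesis .
qed


section \<open>Pairs of Cuntz families with commutation relations\<close>

lemma comp_exchange: "a \<circ> b = c \<circ> d \<Longrightarrow> d \<circ> e = f \<circ> g \<Longrightarrow> a \<circ> (b \<circ> e) = (c \<circ> f) \<circ> g"
  and comp_exchange': "b \<circ> e = f \<circ> g \<Longrightarrow> a \<circ> f = c \<circ> d \<Longrightarrow> (a \<circ> b) \<circ> e = c \<circ> (d \<circ> g)"
  by (simp_all add: fun_eq_iff)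

text \<open>The letter passes through the word one position at a time, possibly changing at each
  exchange. The length is recorded so that degrees can be tracked.\<close>

lemma commute_letter_word:
  assumes comm: "\<And>i j. i \<in> I \<Longrightarrow> j \<in> J \<Longrightarrow> \<exists>i'\<in>I. \<exists>j'\<in>J. A i \<circ> B j = B j' \<circ> A i'"
    and "i \<in> I" "v \<in> lists J"
  shows "\<exists>i'\<in>I. \<exists>v'\<in>lists J. length v' = length v \<and> A i \<circ> word_op B v = word_op B v' \<circ> A i'"
  using assms(3,2)
proof (induction v arbitrary: i)
  case (Cons j v)
  obtain i1 j1 where 1: "i1 \<in> I" "j1 \<in> J" "A i \<circ> B j = B j1 \<circ> A i1"
    using comm Cons.prems Cons.hyps(1) by blast
  obtain i2 v2 where 2: "i2 \<in> I" "v2 \<in> lists J" "length v2 = length v"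
    "A i1 \<circ> word_op B v = word_op B v2 \<circ> A i2"
    using Cons.IH[OF 1(1)] by blast
  have "A i \<circ> word_op B (j # v) = word_op B (j1 # v2) \<circ> A i2"
    using comp_exchange[OF 1(3) 2(4)] by simp
  then show ?case using 1 2 by (intro bexI[of _ i2] bexI[of _ "j1 # v2"]) (auto simp del: word_op_Cons)
qed auto

lemma commute_word_letter:
  assumes comm: "\<And>i j. i \<in> I \<Longrightarrow> j \<in> J \<Longrightarrow> \<exists>i'\<in>I. \<exists>j'\<in>J. A i \<circ> B j = B j' \<circ> A i'"
    and "u \<in> lists I" "j \<in> J"
  shows "\<exists>j'\<in>J. \<exists>u'\<in>lists I. length u' = length u \<and> word_op A u \<circ> B j = B j' \<circ> word_op A u'"
  using assms(2,3)
proof (induction u arbitrary: j)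
  case (Cons i u)
  obtain j1 u1 where 1: "j1 \<in> J" "u1 \<in> lists I" "length u1 = length u"
    "word_op A u \<circ> B j = B j1 \<circ> word_op A u1"
    using Cons.IH[OF Cons.prems] by blast
  obtain i2 j2 where 2: "i2 \<in> I" "j2 \<in> J" "A i \<circ> B j1 = B j2 \<circ> A i2"
    using comm Cons.hyps(1) 1(1) by blast
  have "word_op A (i # u) \<circ> B j = B j2 \<circ> word_op A (i2 # u1)"
    using comp_exchange'[OF 1(4) 2(3)] by simp
  then show ?case using 1 2 by (intro bexI[of _ j2] bexI[of _ "i2 # u1"]) (auto simp del: word_op_Cons)
qed auto

text \<open>Moves the cut between letter and word: a letter entering on the left pushes another one
  out on the right, and the remaining word keeps its length. The empty word pushes out
  \<open>i\<close> itself.\<close>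

lemma lists_Cons_eq_snoc:
  assumes "u \<in> lists I" "i \<in> I"
  shows "\<exists>u'\<in>lists I. \<exists>a\<in>I. length u' = length u \<and> i # u = u' @ [a]"
proof (cases u rule: rev_exhaust)
  case (snoc w a)
  then show ?thesis using assms by (intro bexI[of _ "i # w"] bexI[of _ a]) auto
qed (use assms in auto)

lemma lists_snoc_eq_Cons:
  assumes "u \<in> lists I" "i \<in> I"
  shows "\<exists>u'\<in>lists I. \<exists>a\<in>I. length u' = length u \<and> u @ [i] = a # u'"
proof (cases u)
  case (Cons a w)
  then show ?thesis using assms by (intro bexI[of _ "w @ [i]"] bexI[of _ a]) auto
qed (use assms in auto)

text \<open>Of the permutation \<theta> only the existence of exchange relations in both directions
  is retained.\<close>

locale commuting_cuntz_rows =
  fixes S T :: "nat \<Rightarrow> 'a::chilbert_space \<Rightarrow> 'a" and I J :: "nat set"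
  assumes S: "cuntz_row I S" and T: "cuntz_row J T"
    and ST: "i \<in> I \<Longrightarrow> j \<in> J \<Longrightarrow> \<exists>i'\<in>I. \<exists>j'\<in>J. S i \<circ> T j = T j' \<circ> S i'"
    and TS: "j \<in> J \<Longrightarrow> i \<in> I \<Longrightarrow> \<exists>j'\<in>J. \<exists>i'\<in>I. T j \<circ> S i = S i' \<circ> T j'"
begin

definition gens :: "('a \<Rightarrow> 'a) set" where "gens = S ` I \<union> T ` J"

text \<open>Written as a product, so that Cuntz families of products apply directly.\<close>

definition words :: "nat \<Rightarrow> nat \<Rightarrow> (nat list \<times> nat list) set" where
  "words k l = {u \<in> lists I. length u = k} \<times> {v \<in> lists J. length v = l}"

lemma ST_op_Pair [simp]: "ST_op S T (u, v) = word_op S u \<circ> word_op T v"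
  by (simp add: ST_op_def)

lemma cuntz_row_ST_op: "cuntz_row (words k l) (ST_op S T)"
  unfolding words_def ST_op_def by (intro cuntz_row_Times cuntz_row_words S T)

text \<open>Regrouping gives \<open>S i \<circ> word_op S u = word_op S u' \<circ> S b\<close>, and
  \<open>S b\<close> then passes through the word in \<open>T\<close>, so the degree stays
  \<open>(k, l)\<close>. The three lemmas that follow also combine one regrouping with one
  exchange.\<close>

lemma S_ST_op:
  assumes "w \<in> words k l" "i \<in> I"
  shows "\<exists>a\<in>I. \<exists>w'\<in>words k l. S i \<circ> ST_op S T w = ST_op S T w' \<circ> S a"
proof -
  obtain u v where w: "w = (u, v)" "u \<in> lists I" "length u = k" "v \<in> lists J" "length v = l"
    using assms(1) by (auto simp: words_def)
  obtain u' b where u': "u' \<in> lists I" "b \<in> I" "length u' = length u" "i # u = u' @ [b]"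
    using lists_Cons_eq_snoc[OF w(2) assms(2)] by blast
  obtain a v' where v': "a \<in> I" "v' \<in> lists J" "length v' = length v"
    "S b \<circ> word_op T v = word_op T v' \<circ> S a"
    using commute_letter_word[of I J S T, OF ST u'(2) w(4)] by blast
  have "S i \<circ> word_op S u = word_op S u' \<circ> S b"
    using arg_cong[OF u'(4), of "word_op S"] by (simp add: word_op_append)
  then have "S i \<circ> ST_op S T w = ST_op S T (u', v') \<circ> S a"
    using comp_exchange[OF _ v'(4)] by (simp add: w(1))
  moreover have "(u', v') \<in> words k l" using w u' v' by (simp add: words_def)
  ultimately show ?thesis using v'(1) by blast
qed

lemma ST_op_S:
  assumes "w \<in> words k l" "i \<in> I"
  shows "\<exists>a\<in>I. \<exists>w'\<in>words k l. ST_op S T w \<circ> S i = S a \<circ> ST_op S T w'"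
proof -
  obtain u v where w: "w = (u, v)" "u \<in> lists I" "length u = k" "v \<in> lists J" "length v = l"
    using assms(1) by (auto simp: words_def)
  obtain b v' where v': "b \<in> I" "v' \<in> lists J" "length v' = length v"
    "word_op T v \<circ> S i = S b \<circ> word_op T v'"
    using commute_word_letter[of J I T S, OF TS w(4) assms(2)] by blast
  obtain u' a where u': "u' \<in> lists I" "a \<in> I" "length u' = length u" "u @ [b] = a # u'"
    using lists_snoc_eq_Cons[OF w(2) v'(1)] by blast
  have "word_op S u \<circ> S b = S a \<circ> word_op S u'"
    using arg_cong[OF u'(4), of "word_op S"] by (simp add: word_op_append)
  then have "ST_op S T w \<circ> S i = S a \<circ> ST_op S T (u', v')"
    using comp_exchange'[OF v'(4)] by (simp add: w(1))
  moreover have "(u', v') \<in> words k l" using w u' v' by (simp add: words_def)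
  ultimately show ?thesis using u'(2) by blast
qed

lemma T_ST_op:
  assumes "w \<in> words k l" "j \<in> J"
  shows "\<exists>a\<in>J. \<exists>w'\<in>words k l. T j \<circ> ST_op S T w = ST_op S T w' \<circ> T a"
proof -
  obtain u v where w: "w = (u, v)" "u \<in> lists I" "length u = k" "v \<in> lists J" "length v = l"
    using assms(1) by (auto simp: words_def)
  obtain b u' where u': "b \<in> J" "u' \<in> lists I" "length u' = length u"
    "T j \<circ> word_op S u = word_op S u' \<circ> T b"
    using commute_letter_word[of J I T S, OF TS assms(2) w(2)] by blast
  obtain v' a where v': "v' \<in> lists J" "a \<in> J" "length v' = length v" "b # v = v' @ [a]"
    using lists_Cons_eq_snoc[OF w(4) u'(1)] by blast
  have "T b \<circ> word_op T v = word_op T v' \<circ> T a"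
    using arg_cong[OF v'(4), of "word_op T"] by (simp add: word_op_append)
  then have "T j \<circ> ST_op S T w = ST_op S T (u', v') \<circ> T a"
    using comp_exchange[OF u'(4)] by (simp add: w(1))
  moreover have "(u', v') \<in> words k l" using w u' v' by (simp add: words_def)
  ultimately show ?thesis using v'(2) by blast
qed

lemma ST_op_T:
  assumes "w \<in> words k l" "j \<in> J"
  shows "\<exists>a\<in>J. \<exists>w'\<in>words k l. ST_op S T w \<circ> T j = T a \<circ> ST_op S T w'"
proof -
  obtain u v where w: "w = (u, v)" "u \<in> lists I" "length u = k" "v \<in> lists J" "length v = l"
    using assms(1) by (auto simp: words_def)
  obtain v' b where v': "v' \<in> lists J" "b \<in> J" "length v' = length v" "v @ [j] = b # v'"
    using lists_snoc_eq_Cons[OF w(4) assms(2)] by blast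
  obtain a u' where u': "a \<in> J" "u' \<in> lists I" "length u' = length u"
    "word_op S u \<circ> T b = T a \<circ> word_op S u'"
    using commute_word_letter[of I J S T, OF ST w(2) v'(2)] by blast
  have "word_op T v \<circ> T j = T b \<circ> word_op T v'"
    using arg_cong[OF v'(4), of "word_op T"] by (simp add: word_op_append)
  then have "ST_op S T w \<circ> T j = T a \<circ> ST_op S T (u', v')"
    using comp_exchange'[OF _ u'(4)] by (simp add: w(1))
  moreover have "(u', v') \<in> words k l" using w u' v' by (simp add: words_def)
  ultimately show ?thesis using u'(1) by blast
qed

lemma gens_ST_op:
  assumes "w \<in> words k l" "g \<in> gens"
  shows "\<exists>g'\<in>gens. \<exists>w'\<in>words k l. g \<circ> ST_op S T w = ST_op S T w' \<circ> g'"
  using assms S_ST_op T_ST_op unfolding gens_def by blast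

section \<open>The algebra generated by both families\<close>

lemma bounded_gens: "g \<in> gens \<Longrightarrow> bounded_op g"
  using cuntz_rowD(2)[OF S] cuntz_rowD(2)[OF T] by (auto simp: gens_def)

lemma alg: "operator_algebra (wot_alg gens)" "closedin wot (wot_alg gens)" "id \<in> wot_alg gens"
  using wot_algebraD[OF wot_algebra_wot_alg[OF bounded_gens]] by auto

lemma bounded_alg: "A \<in> wot_alg gens \<Longrightarrow> bounded_op A"
  by (rule operator_algebra_bounded[OF alg(1)])

lemma word_op_in_alg:
  shows "u \<in> lists I \<Longrightarrow> word_op S u \<in> wot_alg gens"
    and "v \<in> lists J \<Longrightarrow> word_op T v \<in> wot_alg gens"
proof -
  have "S i \<in> wot_alg gens" if "i \<in> I" for i using that by (simp add: gens_def wot_alg_generator)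
  then show "u \<in> lists I \<Longrightarrow> word_op S u \<in> wot_alg gens"
    by (induction u) (simp_all add: alg(3) operator_algebra_comp[OF alg(1)])
  have "T j \<in> wot_alg gens" if "j \<in> J" for j using that by (simp add: gens_def wot_alg_generator)
  then show "v \<in> lists J \<Longrightarrow> word_op T v \<in> wot_alg gens"
    by (induction v) (simp_all add: alg(3) operator_algebra_comp[OF alg(1)])
qed

lemma ST_op_in_alg: "w \<in> words k l \<Longrightarrow> ST_op S T w \<in> wot_alg gens"
  by (auto simp: words_def intro!: operator_algebra_comp[OF alg(1)] word_op_in_alg)

lemma fsa_subset_alg: "free_semigroup_algebra (words k l) (ST_op S T) \<subseteq> wot_alg gens"
  unfolding free_semigroup_algebra_def
  by (intro wot_alg_least image_subsetI ST_op_in_alg) (simp add: wot_algebra_def alg)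

text \<open>Inserting the sum of the \<open>U w \<circ> adj (U w)\<close> before
  \<open>adj R\<close> completes \<open>R\<close> to the longer products
  \<open>R \<circ> U w\<close>, whose adjoints are under control.\<close>

lemma adj_comp_in_alg:
  assumes U: "cuntz_row W U" "\<And>w. w \<in> W \<Longrightarrow> U w \<in> wot_alg gens"
    and R: "bounded_op R" and A: "\<And>w. w \<in> W \<Longrightarrow> adj (R \<circ> U w) \<circ> A \<in> wot_alg gens"
  shows "adj R \<circ> A \<in> wot_alg gens"
proof -
  have *: "adj R \<circ> A = (\<lambda>x. \<Sum>w\<in>W. (U w \<circ> (adj (R \<circ> U w) \<circ> A)) x)"
    using cuntz_rowD(2,3)[OF U(1)] R by (simp add: fun_eq_iff adj_comp)
  show ?thesis unfolding *
    by (intro operator_algebra_sum operator_algebra_comp alg(1) U(2) A)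
qed

text \<open>A generator is completed to words of degree \<open>(k, l)\<close>: \<open>S i\<close> by
  words of degree \<open>(k - 1, l)\<close> and \<open>T j\<close> by words of degree
  \<open>(k, l - 1)\<close>. Positivity of \<open>k\<close> and \<open>l\<close> makes these
  subtractions exact.\<close>

lemma adj_gens_comp_in_alg:
  assumes "0 < k" "0 < l" and g: "g \<in> gens"
    and A: "\<And>w. w \<in> words k l \<Longrightarrow> adj (ST_op S T w) \<circ> A \<in> wot_alg gens"
  shows "adj g \<circ> A \<in> wot_alg gens"
proof -
  consider i where "i \<in> I" "g = S i" | j where "j \<in> J" "g = T j" using g by (auto simp: gens_def)
  then show ?thesis
  proof cases
    case (1 i)
    show ?thesis
    proof (rule adj_comp_in_alg[OF cuntz_row_ST_op ST_op_in_alg bounded_gens[OF g]])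
      fix w assume w: "w \<in> words (k - 1) l"
      then obtain u v where uv: "w = (u, v)" by (cases w)
      have "(i # u, v) \<in> words k l" using w 1 \<open>0 < k\<close> by (auto simp: words_def uv)
      from A[OF this] show "adj (g \<circ> ST_op S T w) \<circ> A \<in> wot_alg gens"
        by (simp add: uv 1 o_assoc)
    qed
  next
    case (2 j)
    show ?thesis
    proof (rule adj_comp_in_alg[OF cuntz_row_ST_op ST_op_in_alg bounded_gens[OF g]])
      \<comment> \<open>In the normal form the letters of \<open>S\<close> come first, so
        \<open>T j\<close> has to be moved past \<open>word_op S u\<close> before the degree can be
        read off.\<close>
      fix w assume w: "w \<in> words k (l - 1)"
      then obtain u v where uv: "w = (u, v)" "u \<in> lists I" by (auto simp: words_def)
      obtain b u' where u': "b \<in> J" "u' \<in> lists I" "length u' = length u"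
        "T j \<circ> word_op S u = word_op S u' \<circ> T b"
        using commute_letter_word[of J I T S, OF TS 2(1) uv(2)] by blast
      have "(u', b # v) \<in> words k l" using w u' \<open>0 < l\<close> by (auto simp: words_def uv)
      from A[OF this] show "adj (g \<circ> ST_op S T w) \<circ> A \<in> wot_alg gens"
        using u'(4) by (simp add: uv 2 o_assoc)
    qed
  qed
qed

text \<open>The largest subset of the algebra that is stable under left multiplication by the adjoints
  of the generators.\<close>

definition core :: "('a \<Rightarrow> 'a) set" where
  "core = {A. \<forall>gs\<in>lists (adj ` gens). foldr (\<circ>) gs id \<circ> A \<in> wot_alg gens}"

text \<open>Words of adjoints are taken apart at the right end, next to the operator they act on;
  hence the reversed list inductions below.\<close>

lemma foldr_comp_snoc: "foldr (\<circ>) (gs @ [g]) id = foldr (\<circ>) gs id \<circ> g"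
  by (induction gs) (simp_all add: o_assoc)

lemma bounded_foldr: "gs \<in> lists (adj ` gens) \<Longrightarrow> bounded_op (foldr (\<circ>) gs id)"
  by (induction gs) (auto intro!: bounded_op_comp bounded_op_adj simp: bounded_gens)

lemma core_subset_alg: "core \<subseteq> wot_alg gens"
  unfolding core_def by (auto dest: bspec[where x = "[]"])

lemma coreD: "A \<in> core \<Longrightarrow> gs \<in> lists (adj ` gens) \<Longrightarrow> foldr (\<circ>) gs id \<circ> A \<in> wot_alg gens"
  by (simp add: core_def)

lemma adj_gens_core:
  assumes "A \<in> core" "g \<in> gens"
  shows "adj g \<circ> A \<in> core"
  unfolding core_def
proof (intro CollectI ballI)
  fix gs assume "gs \<in> lists (adj ` gens)"
  then have "gs @ [adj g] \<in> lists (adj ` gens)" using assms(2) by auto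
  from coreD[OF assms(1) this] show "foldr (\<circ>) gs id \<circ> (adj g \<circ> A) \<in> wot_alg gens"
    unfolding foldr_comp_snoc by (simp add: o_assoc)
qed

lemma core_zero: "(\<lambda>x. 0) \<in> core"
  by (auto simp: core_def o_def bounded_op_zero[OF bounded_foldr] operator_algebra_zero[OF alg(1)])

lemma core_add:
  assumes "A \<in> core" "B \<in> core"
  shows "(\<lambda>x. A x + B x) \<in> core"
  unfolding core_def
proof (intro CollectI ballI)
  fix gs assume gs: "gs \<in> lists (adj ` gens)"
  have "foldr (\<circ>) gs id \<circ> (\<lambda>x. A x + B x) =
      (\<lambda>x. (foldr (\<circ>) gs id \<circ> A) x + (foldr (\<circ>) gs id \<circ> B) x)"
    by (auto simp: bounded_op_add[OF bounded_foldr[OF gs]])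
  then show "foldr (\<circ>) gs id \<circ> (\<lambda>x. A x + B x) \<in> wot_alg gens"
    using operator_algebra_add[OF alg(1) coreD[OF assms(1) gs] coreD[OF assms(2) gs]] by metis
qed

lemma core_scale:
  assumes "A \<in> core"
  shows "(\<lambda>x. c *\<^sub>C A x) \<in> core"
  unfolding core_def
proof (intro CollectI ballI)
  fix gs assume gs: "gs \<in> lists (adj ` gens)"
  have "foldr (\<circ>) gs id \<circ> (\<lambda>x. c *\<^sub>C A x) = (\<lambda>x. c *\<^sub>C (foldr (\<circ>) gs id \<circ> A) x)"
    by (auto simp: bounded_op_scaleC[OF bounded_foldr[OF gs]])
  then show "foldr (\<circ>) gs id \<circ> (\<lambda>x. c *\<^sub>C A x) \<in> wot_alg gens"
    using operator_algebra_scale[OF alg(1) coreD[OF assms gs]] by metis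
qed

section \<open>The core as a left ideal of the enveloping von Neumann algebra\<close>

lemma gens_comp_rows:
  assumes "R \<in> gens"
  shows "i \<in> I \<Longrightarrow> \<exists>i'\<in>I. \<exists>R'\<in>gens. R \<circ> S i = S i' \<circ> R'"
    and "j \<in> J \<Longrightarrow> \<exists>j'\<in>J. \<exists>R'\<in>gens. R \<circ> T j = T j' \<circ> R'"
  using assms ST TS unfolding gens_def by blast+

text \<open>Insert the sum of the \<open>C i \<circ> adj (C i)\<close> between \<open>R\<close> and
  \<open>A\<close>. After \<open>R \<circ> C i = C i' \<circ> R'\<close> the factor
  \<open>adj (C e)\<close> meets \<open>C i'\<close> and leaves the identity or 0. What remains is
  \<open>h\<close> applied to a generator times \<open>adj (C i) \<circ> A\<close>, which is again
  in the core.\<close>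

lemma gens_core_step:
  assumes C: "cuntz_row E C" "C ` E \<subseteq> gens"
    and cross: "\<And>R i. R \<in> gens \<Longrightarrow> i \<in> E \<Longrightarrow> \<exists>i'\<in>E. \<exists>R'\<in>gens. R \<circ> C i = C i' \<circ> R'"
    and h: "bounded_op h" "\<And>R A. R \<in> gens \<Longrightarrow> A \<in> core \<Longrightarrow> h \<circ> (R \<circ> A) \<in> wot_alg gens"
    and R: "R \<in> gens" and A: "A \<in> core" and e: "e \<in> E"
  shows "h \<circ> adj (C e) \<circ> (R \<circ> A) \<in> wot_alg gens"
proof -
  note c = cuntz_rowD[OF C(1)]
  have b: "bounded_op (h \<circ> adj (C e) \<circ> R)" using h c(2)[OF e] bounded_gens[OF R] by auto
  have *: "h \<circ> adj (C e) \<circ> (R \<circ> A) = (\<lambda>x. \<Sum>i\<in>E. (h \<circ> adj (C e) \<circ> (R \<circ> C i) \<circ> (adj (C i) \<circ> A)) x)"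
    using bounded_op_sum[OF b, of "\<lambda>i. C i (adj (C i) (A _))" E] by (auto simp: c(3))
  have "h \<circ> adj (C e) \<circ> (R \<circ> C i) \<circ> (adj (C i) \<circ> A) \<in> wot_alg gens" if i: "i \<in> E" for i
  proof -
    obtain i' R' where i': "i' \<in> E" "R' \<in> gens" "R \<circ> C i = C i' \<circ> R'" using cross[OF R i] by blast
    have "adj (C i) \<circ> A \<in> core" using adj_gens_core[OF A] C(2) i by blast
    then have "h \<circ> (R' \<circ> (adj (C i) \<circ> A)) \<in> wot_alg gens" by (rule h(2)[OF i'(2)])
    moreover have "h \<circ> adj (C e) \<circ> (R \<circ> C i) \<circ> (adj (C i) \<circ> A) =
        h \<circ> (adj (C e) \<circ> C i') \<circ> (R' \<circ> (adj (C i) \<circ> A))"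
      by (simp add: i'(3) comp_assoc)
    moreover have "h \<circ> (\<lambda>x. 0) \<circ> X = (\<lambda>x. 0)" for X :: "'a \<Rightarrow> 'a"
      by (simp add: fun_eq_iff bounded_op_zero[OF h(1)])
    ultimately show ?thesis
      using c(4)[OF e i'(1)] operator_algebra_zero[OF alg(1)] by (metis comp_id)
  qed
  then show ?thesis unfolding * by (intro operator_algebra_sum alg(1))
qed

text \<open>Induction on the word of adjoints, with the generator and the core element arbitrary
  because both change in each step.\<close>

lemma gens_core:
  assumes "R \<in> gens" "A \<in> core"
  shows "R \<circ> A \<in> core"
proof -
  have "foldr (\<circ>) gs id \<circ> (R \<circ> A) \<in> wot_alg gens" if "gs \<in> lists (adj ` gens)" for gs
    using that assms
  proof (induction gs arbitrary: R A rule: rev_induct)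
    case Nil
    then show ?case
      using operator_algebra_comp[OF alg(1) wot_alg_generator[of R gens] subsetD[OF core_subset_alg, of A]]
      by (simp add: comp_def)
  next
    case (snoc g gs)
    then have gs: "gs \<in> lists (adj ` gens)" and g: "g \<in> adj ` gens" by auto
    note h = bounded_foldr[OF gs] snoc.IH[OF gs]
    consider i where "i \<in> I" "g = adj (S i)" | j where "j \<in> J" "g = adj (T j)"
      using g by (auto simp: gens_def)
    then show ?case
    proof cases
      case (1 i)
      show ?thesis unfolding foldr_comp_snoc 1(2)
        by (rule gens_core_step[OF S _ gens_comp_rows(1) h snoc.prems(2,3) 1(1)])
          (auto simp: gens_def)
    next
      case (2 j)
      show ?thesis unfolding foldr_comp_snoc 2(2)
        by (rule gens_core_step[OF T _ gens_comp_rows(2) h snoc.prems(2,3) 2(1)])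
          (auto simp: gens_def)
    qed
  qed
  then show ?thesis by (simp add: core_def)
qed

text \<open>The operators that, together with their adjoints, map the core into itself by left
  multiplication form a von Neumann algebra containing the generators.\<close>

lemma vn_alg_core:
  assumes "B \<in> vn_alg (wot_alg gens)" "A \<in> core"
  shows "B \<circ> A \<in> core"
proof -
  define N where "N = {B. bounded_op B \<and> (\<forall>A\<in>core. B \<circ> A \<in> core \<and> adj B \<circ> A \<in> core)}"
  define D where "D = lists (adj ` gens) \<times> core"
  have "operator_algebra N" unfolding operator_algebra_def
  proof (intro conjI ballI allI)
    fix A B c assume A: "A \<in> N" and B: "B \<in> N"
    have b: "bounded_op A" "bounded_op B" using A B by (auto simp: N_def)
    show "bounded_op A" by (rule b)
    show "(\<lambda>x. A x + B x) \<in> N"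
      using A B core_add by (auto simp: N_def adj_plus o_def)
    show "(\<lambda>x. c *\<^sub>C A x) \<in> N"
      using A core_scale by (auto simp: N_def adj_scale o_def)
    show "A \<circ> B \<in> N" using A B by (auto simp: N_def adj_comp comp_assoc)
  qed (auto simp: N_def core_zero o_def)
  moreover have "id \<in> N" by (simp add: N_def)
  moreover have "closedin wot N"
  proof -
    have D: "bounded_op (foldr (\<circ>) (fst p) id)" "bounded_op (snd p)" if "p \<in> D" for p
      using that core_subset_alg bounded_foldr bounded_alg unfolding D_def mem_Times_iff by blast+
    \<comment> \<open>Core membership is unfolded into separate conditions on \<open>B\<close>, each
      the preimage of the closed set \<open>wot_alg gens\<close> under a WOT-continuous map.\<close>
    have *: "N = {B \<in> {B \<in> {B. bounded_op B}. \<forall>p\<in>D. foldr (\<circ>) (fst p) id \<circ> B \<circ> snd p \<in> wot_alg gens}.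
        \<forall>p\<in>D. foldr (\<circ>) (fst p) id \<circ> adj B \<circ> snd p \<in> wot_alg gens}"
      by (auto simp: N_def D_def core_def comp_assoc)
    have **: "continuous_map wot wot (\<lambda>B. foldr (\<circ>) (fst p) id \<circ> adj B \<circ> snd p)"
      if "p \<in> D" for p
      using continuous_map_compose[OF continuous_map_wot_adj continuous_map_wot_sandwich[OF D[OF that]]]
      by (simp add: o_def)
    show ?thesis unfolding *
      by (intro closedin_wot_Ball closedin_bounded_ops alg(2) continuous_map_wot_sandwich ** D)
  qed
  ultimately have N: "wot_algebra N" by (simp add: wot_algebra_def)
  have "gens \<subseteq> N" by (auto simp: N_def bounded_gens gens_core adj_gens_core)
  then have "wot_alg gens \<subseteq> N" by (rule wot_alg_least[OF N])
  moreover have "self_adjoint_set N" by (auto simp: self_adjoint_set_def N_def adj_adj)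
  ultimately have "vn_alg (wot_alg gens) \<subseteq> N" using N by (intro vn_alg_least)
  then show ?thesis using assms by (auto simp: N_def)
qed

text \<open>Stability under adjoints of words of one fixed degree already suffices: multiplying
  \<open>Y\<close> by adjoints of generators stays in the algebra and produces a set with the same
  stability, so the step can be iterated.\<close>

lemma subset_core:
  assumes kl: "0 < k" "0 < l" and "Y \<subseteq> wot_alg gens"
    and "\<And>A w. A \<in> Y \<Longrightarrow> w \<in> words k l \<Longrightarrow> adj (ST_op S T w) \<circ> A \<in> Y"
  shows "Y \<subseteq> core"
proof -
  have "foldr (\<circ>) gs id \<circ> A \<in> wot_alg gens" if "gs \<in> lists (adj ` gens)" "A \<in> Y" for gs A
    using that assms(3,4)
  proof (induction gs arbitrary: Y A rule: rev_induct)
    case Nil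
    then show ?case by auto
  next
    case (snoc g gs)
    then obtain h where gs: "gs \<in> lists (adj ` gens)" and h: "h \<in> gens" "g = adj h" by auto
    \<comment> \<open>The induction hypothesis is used for \<open>Y'\<close>, which requires the
      induction to be general in \<open>Y\<close>. Its stability follows from the adjoint of the
      relation moving a generator through a word.\<close>
    define Y' where "Y' = {adj h \<circ> A |h A. h \<in> gens \<and> A \<in> Y}"
    have "foldr (\<circ>) gs id \<circ> (g \<circ> A) \<in> wot_alg gens"
    proof (rule snoc.IH[OF gs, of _ Y'])
      show "g \<circ> A \<in> Y'" using h snoc.prems(2) by (auto simp: Y'_def)
      show "Y' \<subseteq> wot_alg gens"
      proof
        fix B assume "B \<in> Y'"
        then obtain h A where B: "h \<in> gens" "A \<in> Y" "B = adj h \<circ> A" unfolding Y'_def by blast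
        show "B \<in> wot_alg gens" unfolding B(3)
          by (rule adj_gens_comp_in_alg[OF kl B(1)]) (use snoc.prems(3,4) B(2) in blast)
      qed
      fix B w assume "B \<in> Y'" and w: "w \<in> words k l"
      then obtain h A where B: "h \<in> gens" "A \<in> Y" "B = adj h \<circ> A" unfolding Y'_def by blast
      obtain h' w' where h': "h' \<in> gens" "w' \<in> words k l" "h \<circ> ST_op S T w = ST_op S T w' \<circ> h'"
        using gens_ST_op[OF w B(1)] by blast
      have "bounded_op (ST_op S T w)" "bounded_op (ST_op S T w')"
        using w h'(2) ST_op_in_alg bounded_alg by blast+
      then have "adj (ST_op S T w) \<circ> adj h = adj h' \<circ> adj (ST_op S T w')"
        using adj_comp[of h "ST_op S T w"] adj_comp[of "ST_op S T w'" h'] h' B(1) bounded_gens by metis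
      then have "adj (ST_op S T w) \<circ> B = adj h' \<circ> (adj (ST_op S T w') \<circ> A)"
        unfolding B(3) by (simp add: o_assoc)
      then show "adj (ST_op S T w) \<circ> B \<in> Y'"
        using h'(1) snoc.prems(4)[OF B(2) h'(2)] unfolding Y'_def by blast
    qed
    then show ?case unfolding foldr_comp_snoc by (simp only: comp_assoc)
  qed
  then show ?thesis by (auto simp: core_def)
qed

text \<open>The left multiples of \<open>Q\<close> by the von Neumann algebra of the free semigroup
  algebra are stable under adjoints of words, so they lie in the core. In particular
  \<open>Q\<close> does, and the core is closed under left multiplication by the larger von Neumann
  algebra.\<close>

lemma structure_projection_vn_alg_comp:
  assumes kl: "0 < k" "0 < l" and Q: "structure_projection (words k l) (ST_op S T) Q"
    and B: "B \<in> vn_alg (wot_alg gens)"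
  shows "B \<circ> Q \<in> wot_alg gens"
proof -
  let ?A = "free_semigroup_algebra (words k l) (ST_op S T)"
  have bd: "bounded_op (ST_op S T w)" if "w \<in> words k l" for w
    using that ST_op_in_alg bounded_alg by blast
  have "\<And>A. A \<in> ?A \<Longrightarrow> bounded_op A" using fsa_subset_alg bounded_alg by blast
  from wot_algebra_vn_alg[of ?A, OF this]
  have vn: "operator_algebra (vn_alg ?A)" "self_adjoint_set (vn_alg ?A)" "id \<in> vn_alg ?A"
    by (auto simp: wot_algebra_def)
  define Y where "Y = {B \<circ> Q |B. B \<in> vn_alg ?A}"
  have "Y \<subseteq> core"
  proof (rule subset_core[OF kl])
    show "Y \<subseteq> wot_alg gens"
      using structure_projection_left_ideal[OF bd Q] fsa_subset_alg by (auto simp: Y_def)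
    fix A w assume "A \<in> Y" and w: "w \<in> words k l"
    then obtain B where "B \<in> vn_alg ?A" "A = B \<circ> Q" by (auto simp: Y_def)
    moreover have "ST_op S T w \<in> vn_alg ?A" unfolding free_semigroup_algebra_def
      by (intro vn_alg_generator wot_alg_generator imageI w)
    then have "adj (ST_op S T w) \<in> vn_alg ?A" using vn(2) by (simp add: self_adjoint_set_def)
    ultimately show "adj (ST_op S T w) \<circ> A \<in> Y"
      using operator_algebra_comp[OF vn(1)] unfolding Y_def by (metis (mono_tags, lifting) comp_assoc mem_Collect_eq)
  qed
  moreover have "Q \<in> Y" using vn(3) unfolding Y_def by (auto intro!: exI[of _ id])
  ultimately show ?thesis using vn_alg_core[OF B] core_subset_alg by blast
qed

text \<open>Invariance under the two generating families extends to the algebra because the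
  operators leaving the kernel of \<open>Q\<close> invariant form a WOT-closed algebra.\<close>

lemma structure_projection_alg_invariant:
  assumes Q: "structure_projection (words k l) (ST_op S T) Q"
    and A: "A \<in> wot_alg gens" and x: "Q x = 0"
  shows "Q (A x) = 0"
proof -
  have prQ: "projection Q" using Q by (simp add: structure_projection_def Let_def)
  note q = projectionD[OF prQ]
  have bp: "bounded_op (perp Q)"
    using operator_algebra_perp[OF operator_algebra_bounded_ops] q(1) by auto
  have p: "perp Q y = y" if "Q y = 0" for y using that by (simp add: perp_def)
  have Qp: "Q (perp Q y) = 0" for y using range_perp[OF prQ] by blast
  \<comment> \<open>The sandwich form shows closedness, the equivalent kernel form below the algebra
    properties.\<close>
  define Y where "Y = {A \<in> wot_alg gens. Q \<circ> A \<circ> perp Q \<in> {\<lambda>x. 0}}"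
  have Y: "A \<in> Y \<longleftrightarrow> A \<in> wot_alg gens \<and> (\<forall>x. Q x = 0 \<longrightarrow> Q (A x) = 0)" for A
    using p Qp by (auto simp: Y_def fun_eq_iff) metis
  have "operator_algebra Y" unfolding operator_algebra_def
    using alg(1) bounded_alg
    by (auto simp: Y operator_algebra_def bounded_op_add[OF q(1)] bounded_op_scaleC[OF q(1)] bounded_op_zero[OF q(1)])
  moreover have "closedin wot Y" unfolding Y_def
    by (intro closedin_continuous_map_preimage_gen[OF continuous_map_wot_sandwich] q bp alg closedin_wot_zero)
  moreover have "id \<in> Y" using alg by (simp add: Y)
  moreover have "gens \<subseteq> Y"
    using structure_projection_perp_invariant[OF cuntz_row_ST_op S Q ST_op_S S_ST_op]
      structure_projection_perp_invariant[OF cuntz_row_ST_op T Q ST_op_T T_ST_op]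
    by (auto simp: Y gens_def wot_alg_generator)
  ultimately have "wot_alg gens \<subseteq> Y" by (intro wot_alg_least) (simp_all add: wot_algebra_def)
  then show ?thesis using A x by (auto simp: Y)
qed

end


section \<open>Meets of commuting projections\<close>

lemma closed_csubspace_INT:
  "(\<And>i. i \<in> I \<Longrightarrow> closed_csubspace (K i)) \<Longrightarrow> closed_csubspace (\<Inter>i\<in>I. K i)"
  unfolding closed_csubspace_def by (intro conjI closed_INT) auto

text \<open>The term \<open>rec_nat\<close> is the product of \<open>Q 0\<close> up to
  \<open>Q k\<close>. Commutation makes these products a decreasing sequence of projections, which
  converges strongly to the projection onto the intersection.\<close>

lemma proj_Inter_strong_limit:
  fixes Q :: "nat \<Rightarrow> 'a::chilbert_space \<Rightarrow> 'a"
  assumes Q: "\<And>i. projection (Q i)" and comm: "\<And>i j. Q i \<circ> Q j = Q j \<circ> Q i"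
  shows "(\<lambda>k. rec_nat (Q 0) (\<lambda>k R. Q (Suc k) \<circ> R) k x) \<longlonglongrightarrow> proj (\<Inter>i. range (Q i)) x"
proof -
  define R where "R = rec_nat (Q 0) (\<lambda>k R. Q (Suc k) \<circ> R)"
  have R0 [simp]: "R 0 = Q 0" and RS [simp]: "R (Suc k) = Q (Suc k) \<circ> R k" for k by (simp_all add: R_def)
  note q = projectionD[OF Q]
  have qc: "Q i (Q j z) = Q j (Q i z)" for i j z using comm by (metis comp_apply)
  have Rc: "Q i (R k z) = R k (Q i z)" for i k z
  proof (induction k)
    case (Suc k)
    then show ?case using qc[of i "Suc k" "R k z"] by simp
  qed (simp add: qc[of i 0])
  have sa: "cinner (R k y) z = cinner y (R k z)" for k y z
  proof (induction k arbitrary: y z)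
    case (Suc k)
    then show ?case by (simp add: q(3) Rc)
  qed (simp add: q(3))
  have QR: "Q i (R k z) = R k z" if "i \<le> k" for i k z
    using that
  proof (induction k)
    case (Suc k)
    then show ?case by (cases "i = Suc k") (auto simp: q(2) qc[of i "Suc k"])
  qed (simp add: q(2))
  have fixed: "R k z = z" if "\<And>i. i \<le> k \<Longrightarrow> Q i z = z" for k z
    using that by (induction k) auto
  have RR: "R k (R m z) = R m z" if "k \<le> m" for k m z
    using that by (intro fixed QR) auto
  \<comment> \<open>Pythagoras for nested projections; it turns convergence of the decreasing norms
    into the Cauchy property of the vectors.\<close>
  have pyth: "(norm (R k x - R m x))\<^sup>2 = (norm (R k x))\<^sup>2 - (norm (R m x))\<^sup>2" if "k \<le> m" for k m
  proof -
    have "inner (R k x) (R m x) = inner (R m x) (R m x)"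
      using sa[of k x "R m x"] sa[of m x "R m x"] RR[OF that] RR[of m m] by (simp add: inner_eq_Re_cinner)
    then show ?thesis
      by (simp add: power2_norm_eq_inner inner_diff_left inner_diff_right inner_commute)
  qed
  have dec: "(norm (R m x))\<^sup>2 \<le> (norm (R k x))\<^sup>2" if "k \<le> m" for k m
    using pyth[OF that] zero_le_power2[of "norm (R k x - R m x)"] by linarith
  have "decseq (\<lambda>k. (norm (R k x))\<^sup>2)" using dec by (simp add: decseq_def)
  then have "convergent (\<lambda>k. (norm (R k x))\<^sup>2)"
    using decseq_convergent[of _ 0] unfolding convergent_def by (metis zero_le_power2)
  then have cauchy: "Cauchy (\<lambda>k. (norm (R k x))\<^sup>2)" by (rule convergent_Cauchy)
  have "Cauchy (\<lambda>k. R k x)"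
  proof (rule metric_CauchyI)
    fix e :: real assume e: "0 < e"
    then obtain N where N: "\<And>k m. N \<le> k \<Longrightarrow> N \<le> m \<Longrightarrow> dist ((norm (R k x))\<^sup>2) ((norm (R m x))\<^sup>2) < e\<^sup>2"
      using metric_CauchyD[OF cauchy, of "e\<^sup>2"] by auto
    have less: "dist (R k x) (R m x) < e" if "N \<le> k" "k \<le> m" for k m
    proof -
      have "(norm (R k x - R m x))\<^sup>2 < e\<^sup>2"
        using N[of k m] that pyth[OF that(2)] by (simp add: dist_real_def)
      then show ?thesis using e by (simp add: dist_norm power2_less_imp_less)
    qed
    then show "\<exists>M. \<forall>k\<ge>M. \<forall>m\<ge>M. dist (R k x) (R m x) < e"
      by (metis dist_commute nle_le)
  qed
  then obtain y where y: "(\<lambda>k. R k x) \<longlonglongrightarrow> y" using Cauchy_convergent convergent_def by blast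
  have "Q i y = y" for i
  proof (rule LIMSEQ_unique[OF _ y])
    have "(\<lambda>k. Q i (R k x)) \<longlonglongrightarrow> Q i y"
      by (rule bounded_linear.tendsto[OF conjunct1[OF q(1)[of i, unfolded bounded_op_def]] y])
    moreover have "eventually (\<lambda>k. Q i (R k x) = R k x) sequentially"
      using QR by (auto simp: eventually_sequentially)
    ultimately show "(\<lambda>k. R k x) \<longlonglongrightarrow> Q i y" by (rule Lim_transform_eventually)
  qed
  then have yK: "y \<in> (\<Inter>i. range (Q i))" by (simp add: range_projection[OF Q])
  have "cinner z (x - y) = 0" if "z \<in> (\<Inter>i. range (Q i))" for z
  proof (rule LIMSEQ_unique)
    have "R k z = z" for k using that by (intro fixed) (auto simp: range_projection[OF Q])
    then have "cinner z (x - R k x) = 0" for k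
      using sa[of k z x] by (simp add: cinner_diff_right)
    then show "(\<lambda>k. cinner z (x - R k x)) \<longlonglongrightarrow> 0" by simp
    show "(\<lambda>k. cinner z (x - R k x)) \<longlonglongrightarrow> cinner z (x - y)"
      by (intro tendsto_cinner tendsto_intros y)
  qed
  moreover have "closed_csubspace (\<Inter>i. range (Q i))"
    by (intro closed_csubspace_INT closed_csubspace_range_projection Q)
  ultimately have "proj (\<Inter>i. range (Q i)) x = y" using yK by (intro proj_eqI)
  then show ?thesis using y by (simp add: R_def)
qed

text \<open>No graph structure is left here: each \<open>Q c\<close> multiplies the von Neumann
  algebra into \<open>SS\<close> from the right and has an invariant complement. These force the
  projections to commute, and both properties pass to their meet.\<close>

lemma decomposition_by_absorbing_projections:
  fixes Q :: "'c \<Rightarrow> 'a::chilbert_space \<Rightarrow> 'a" and P :: "'a \<Rightarrow> 'a"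
  assumes SS: "wot_algebra SS" and C: "countable C" "C \<noteq> {}"
    and Q: "\<And>c. c \<in> C \<Longrightarrow> projection (Q c)"
    and absorb: "\<And>c B. c \<in> C \<Longrightarrow> B \<in> vn_alg SS \<Longrightarrow> B \<circ> Q c \<in> SS"
    and inv: "\<And>c A. c \<in> C \<Longrightarrow> A \<in> SS \<Longrightarrow> \<forall>x. Q c x = 0 \<longrightarrow> Q c (A x) = 0"
    and P: "P = proj (\<Inter>c\<in>C. range (Q c))"
  shows "self_adjoint_set {P \<circ> A \<circ> P | A. A \<in> SS}"
    and "invariant_under SS (range (perp P))"
    and "SS = {(\<lambda>x. (A \<circ> P) x + (perp P \<circ> B \<circ> perp P) x) | A B. A \<in> vn_alg SS \<and> B \<in> SS}"
proof -
  note s = wot_algebraD[OF SS]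
  have bS: "bounded_op A" if "A \<in> SS" for A using operator_algebra_bounded[OF s(1) that] .
  have "\<And>A. A \<in> SS \<Longrightarrow> bounded_op A" by (rule bS)
  from wot_algebra_vn_alg[of SS, OF this]
  have vn: "operator_algebra (vn_alg SS)" "self_adjoint_set (vn_alg SS)" "id \<in> vn_alg SS"
    by (auto simp: wot_algebra_def)
  have SV: "A \<in> vn_alg SS" if "A \<in> SS" for A using that by (rule vn_alg_generator)
  have adjV: "adj A \<in> vn_alg SS" if "A \<in> vn_alg SS" for A
    using that vn(2) by (simp add: self_adjoint_set_def)
  have QS: "Q c \<in> SS" if "c \<in> C" for c using absorb[OF that vn(3)] by simp
  note q = projectionD[OF Q]
  have Qperp: "Q c (A (x - Q c x)) = 0" if "c \<in> C" "A \<in> SS" for c A x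
    using inv[OF that, rule_format, of "x - Q c x"] q(1,2)[OF that(1)] by (simp add: bounded_op_diff)
  have QA: "Q c (A (Q c x)) = Q c (A x)" if "c \<in> C" "A \<in> SS" for c A x
    using Qperp[OF that, of x] bounded_op_diff[OF bS[OF that(2)]] bounded_op_diff[OF q(1)[OF that(1)]]
    by simp
  \<comment> \<open>Adjoint form of \<open>QA\<close>: the range of \<open>Q c\<close> is invariant
    under the adjoints of elements of \<open>SS\<close>.\<close>
  have AQ: "Q c (adj A (Q c x)) = adj A (Q c x)" if "c \<in> C" "A \<in> SS" for c A x
  proof (rule cinner_eqI)
    fix y
    show "cinner y (Q c (adj A (Q c x))) = cinner y (adj A (Q c x))"
      using QA[OF that, of y] by (simp add: cinner_adj_right bS[OF that(2)] flip: q(3)[OF that(1)])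
  qed
  \<comment> \<open>As \<open>Q d\<close> is a self-adjoint element of \<open>SS\<close>, both
    \<open>QA\<close> and \<open>AQ\<close> apply to it and evaluate
    \<open>Q c \<circ> Q d \<circ> Q c\<close> as \<open>Q c \<circ> Q d\<close> and as
    \<open>Q d \<circ> Q c\<close>.\<close>
  have comm: "Q c \<circ> Q d = Q d \<circ> Q c" if "c \<in> C" "d \<in> C" for c d
  proof -
    have 1: "Q c (Q d (Q c x)) = Q c (Q d x)" for x using QA[OF that(1) QS[OF that(2)]] .
    have 2: "Q c (Q d (Q c x)) = Q d (Q c x)" for x
      using AQ[OF that(1) QS[OF that(2)]] q(4)[OF that(2)] by simp
    show ?thesis using 1 2 by (simp add: fun_eq_iff)
  qed
  define K where "K = (\<Inter>c\<in>C. range (Q c))"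
  have K: "closed_csubspace K"
    unfolding K_def by (intro closed_csubspace_INT closed_csubspace_range_projection Q)
  have prP: "projection P" and rP: "range P = K" using projection_proj[OF K] by (simp_all add: P K_def)
  note p = projectionD[OF prP]
  have Kiff: "x \<in> K \<longleftrightarrow> (\<forall>c\<in>C. Q c x = x)" for x by (simp add: K_def range_projection[OF Q])
  have PS: "P \<in> SS"
  proof -
    \<comment> \<open>An enumeration of \<open>C\<close>; repetitions do no harm, so finite and
      infinite \<open>C\<close> are treated alike.\<close>
    define e where "e = from_nat_into C"
    have e: "e i \<in> C" for i using C(2) by (simp add: e_def from_nat_into)
    have re: "range e = C" using C by (simp add: e_def range_from_nat_into)
    define R where "R = rec_nat (Q (e 0)) (\<lambda>k R. Q (e (Suc k)) \<circ> R)"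
    have R: "R 0 = Q (e 0)" "R (Suc k) = Q (e (Suc k)) \<circ> R k" for k by (simp_all add: R_def)
    have "R k \<in> SS" for k
      by (induction k) (simp_all only: R QS[OF e] operator_algebra_comp[OF s(1)])
    moreover have "(\<lambda>k. R k x) \<longlonglongrightarrow> P x" for x
    proof -
      have "(\<Inter>i. range (Q (e i))) = K" unfolding K_def re[symmetric] by simp
      then show ?thesis
        using proj_Inter_strong_limit[of "\<lambda>i. Q (e i)" x] Q comm e by (simp add: R_def P K_def)
    qed
    ultimately show ?thesis by (intro closedin_wot_LIMSEQ[OF s(2) _ p(1)])
  qed
  \<comment> \<open>One index \<open>c\<close> suffices: \<open>P\<close> lies below
    \<open>Q c\<close>, so \<open>A \<circ> P = (A \<circ> P) \<circ> Q c\<close>, and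
    \<open>A \<circ> P\<close> is in the von Neumann algebra.\<close>
  have absorbP: "A \<circ> P \<in> SS" if "A \<in> vn_alg SS" for A
  proof -
    obtain c where c: "c \<in> C" using C(2) by blast
    have QP: "Q c (P x) = P x" for x using Kiff[of "P x"] rP c by blast
    have "P (Q c x) = P x" for x
    proof (rule cinner_eqI)
      fix y
      show "cinner y (P (Q c x)) = cinner y (P x)" by (simp flip: p(3) add: QP q(3)[OF c, symmetric])
    qed
    then have "A \<circ> P = A \<circ> P \<circ> Q c" by (simp add: fun_eq_iff)
    moreover have "A \<circ> P \<in> vn_alg SS" using that PS SV operator_algebra_comp[OF vn(1)] by blast
    ultimately show ?thesis using absorb[OF c] by metis
  qed
  have adjP: "P (adj A (P x)) = adj A (P x)" if "A \<in> SS" for A x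
  proof -
    have Px: "Q c (P x) = P x" if "c \<in> C" for c using Kiff[of "P x"] rP that by blast
    have "Q c (adj A (P x)) = adj A (P x)" if "c \<in> C" for c
      using AQ[OF that \<open>A \<in> SS\<close>, of "P x"] by (simp add: Px[OF that])
    then have "adj A (P x) \<in> range P" by (simp add: rP Kiff)
    then show ?thesis by (simp add: range_projection[OF prP])
  qed
  have PA: "P (A x) = 0" if "A \<in> SS" "P x = 0" for A x
  proof (rule cinner_eqI)
    fix y
    have "cinner y (P (A x)) = cinner (adj A (P y)) x"
      by (simp add: cinner_adj_left bS that flip: p(3))
    also have "\<dots> = cinner (P (adj A (P y))) x" by (simp add: adjP that)
    also have "\<dots> = 0" by (simp add: p(3) that)
    finally show "cinner y (P (A x)) = cinner y 0" by simp
  qed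
  show "self_adjoint_set {P \<circ> A \<circ> P | A. A \<in> SS}"
    unfolding self_adjoint_set_def
  proof
    fix B assume "B \<in> {P \<circ> A \<circ> P | A. A \<in> SS}"
    then obtain A where A: "A \<in> SS" "B = P \<circ> A \<circ> P" by blast
    \<comment> \<open>Writing the compression this way exhibits it as that of
      \<open>adj A \<circ> P\<close>, which belongs to \<open>SS\<close> although
      \<open>adj A\<close> need not.\<close>
    have "adj B = P \<circ> (adj A \<circ> P) \<circ> P"
      unfolding A(2) using bS[OF A(1)] p(1,2,4) by (simp add: adj_comp bounded_op_comp fun_eq_iff)
    then show "adj B \<in> {P \<circ> A \<circ> P | A. A \<in> SS}" using absorbP[OF adjV[OF SV[OF A(1)]]] by blast
  qed
  show "invariant_under SS (range (perp P))"
    unfolding invariant_under_def using closed_csubspace_range_perp[OF prP] PA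
    by (auto simp: range_perp[OF prP])
  show "SS = {(\<lambda>x. (A \<circ> P) x + (perp P \<circ> B \<circ> perp P) x) | A B. A \<in> vn_alg SS \<and> B \<in> SS}" (is "_ = ?D")
  proof (intro equalityI subsetI)
    fix A assume A: "A \<in> SS"
    \<comment> \<open>The corner \<open>P \<circ> A \<circ> perp P\<close> vanishes, so
      \<open>A \<circ> perp P\<close> equals \<open>perp P \<circ> A \<circ> perp P\<close>, and
      \<open>A\<close> itself serves as both witnesses.\<close>
    have "P (A (perp P x)) = 0" for x using PA[OF A, of "perp P x"] range_perp[OF prP] by blast
    then have "A = (\<lambda>x. (A \<circ> P) x + (perp P \<circ> A \<circ> perp P) x)"
      by (simp add: fun_eq_iff perp_def bounded_op_diff[OF bS[OF A]])
    then show "A \<in> ?D" using A SV[OF A] by blast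
  next
    fix X assume "X \<in> ?D"
    then obtain A B where AB: "A \<in> vn_alg SS" "B \<in> SS"
      "X = (\<lambda>x. (A \<circ> P) x + (perp P \<circ> B \<circ> perp P) x)" by blast
    show "X \<in> SS" unfolding AB(3)
      by (intro operator_algebra_add[OF s(1)] operator_algebra_comp[OF s(1)] absorbP
          operator_algebra_perp s PS AB(1,2))
  qed
qed

section \<open>Application to single vertex 2-graphs\<close>

lemma single_vertex_2graph_converse:
  assumes "single_vertex_2graph m n \<theta>" "i' \<in> {1..m}" "j' \<in> {1..n}"
  obtains i j where "i \<in> {1..m}" "j \<in> {1..n}" "\<theta> (i, j) = (i', j')"
proof -
  have "\<theta> ` ({1..m} \<times> {1..n}) = {1..m} \<times> {1..n}"
    using assms(1) permutes_image unfolding single_vertex_2graph_def by blast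
  then have "(i', j') \<in> \<theta> ` ({1..m} \<times> {1..n})" using assms by simp
  then show thesis using that by auto
qed

theorem theorem4p6:
  fixes S T :: "nat \<Rightarrow> 'a::chilbert_space \<Rightarrow> 'a"
    and \<theta> :: "nat \<times> nat \<Rightarrow> nat \<times> nat"
    and m n :: nat
    and P :: "'a \<Rightarrow> 'a"
  assumes "single_vertex_2graph m n \<theta>"
    and "isometric_rep m n \<theta> S T"
    and "cuntz_type m n S T"
    and "first_structure_projection m n S T P"
  shows "self_adjoint_set {P \<circ> A \<circ> P | A. A \<in> two_graph_algebra m n S T} \<and>
    invariant_under (two_graph_algebra m n S T) (range (perp P)) \<and>
    two_graph_algebra m n S T =
      {(\<lambda>x. (A \<circ> P) x + (perp P \<circ> B \<circ> perp P) x) | A B.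
        A \<in> vn_alg (two_graph_algebra m n S T) \<and> B \<in> two_graph_algebra m n S T}"
proof -
  have perm: "\<theta> permutes {1..m} \<times> {1..n}" using assms(1) by (simp add: single_vertex_2graph_def)
  have rel: "S i \<circ> T j = T j' \<circ> S i'" if "i \<in> {1..m}" "j \<in> {1..n}" "\<theta> (i, j) = (i', j')" for i j i' j'
    using assms(2) that unfolding isometric_rep_def by blast
  interpret commuting_cuntz_rows S T "{1..m}" "{1..n}"
  proof
    show "cuntz_row {1..m} S" "cuntz_row {1..n} T"
      using assms(2,3) by (simp_all add: isometric_rep_def cuntz_type_def cuntz_row_def)
  next
    fix i j assume ij: "i \<in> {1..m}" "j \<in> {1..n}"
    obtain i' j' where \<theta>: "\<theta> (i, j) = (i', j')" by fastforce
    have "\<theta> (i, j) \<in> {1..m} \<times> {1..n}" using permutes_in_image[OF perm] ij by blast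
    then have "i' \<in> {1..m}" "j' \<in> {1..n}" unfolding \<theta> by blast+
    then show "\<exists>i'\<in>{1..m}. \<exists>j'\<in>{1..n}. S i \<circ> T j = T j' \<circ> S i'" using rel[OF ij \<theta>] by blast
  next
    \<comment> \<open>The reverse exchange reads the relation backwards at a preimage of the pair
      under \<theta>, which exists because \<theta> is onto.\<close>
    fix j i assume ij: "j \<in> {1..n}" "i \<in> {1..m}"
    obtain i' j' where "i' \<in> {1..m}" "j' \<in> {1..n}" "\<theta> (i', j') = (i, j)"
      using single_vertex_2graph_converse[OF assms(1) ij(2,1)] by blast
    then show "\<exists>j'\<in>{1..n}. \<exists>i'\<in>{1..m}. T j \<circ> S i = S i' \<circ> T j'" using rel by metis
  qed
  have alg_eq: "two_graph_algebra m n S T = wot_alg gens" by (simp only: two_graph_algebra_def gens_def)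
  have words_eq: "words_of_degree m n k l = words k l" for k l
    unfolding words_of_degree_def words_def by auto
  obtain Q where Q: "\<And>k l. 0 < k \<Longrightarrow> 0 < l \<Longrightarrow> structure_projection (words k l) (ST_op S T) (Q k l)"
    and P: "P = proj (\<Inter>k\<in>{0<..}. \<Inter>l\<in>{0<..}. range (Q k l))"
    using assms(4) unfolding first_structure_projection_def words_eq by blast
  \<comment> \<open>Uncurrying turns the double intersection into one over a countable set of
    pairs.\<close>
  define R where "R = case_prod Q"
  have R [simp]: "R (k, l) = Q k l" for k l by (simp add: R_def)
  have P': "P = proj (\<Inter>c\<in>{0<..} \<times> {0<..}. range (R c))"
    unfolding P by (rule arg_cong[of _ _ proj]) auto
  have W: "wot_algebra (wot_alg gens)" using alg unfolding wot_algebra_def by blast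
  have ne: "{0<..} \<times> {0<..} \<noteq> ({} :: (nat \<times> nat) set)" by auto
  have 1: "projection (R c)" if "c \<in> {0<..} \<times> {0<..}" for c
    using that Q by (auto simp: structure_projection_def Let_def)
  have 2: "B \<circ> R c \<in> wot_alg gens"
    if c: "c \<in> {0<..} \<times> {0<..}" and B: "B \<in> vn_alg (wot_alg gens)" for B c
  proof -
    obtain k l where kl: "c = (k, l)" "0 < k" "0 < l" using c by auto
    show ?thesis unfolding kl(1) R
      by (rule structure_projection_vn_alg_comp[OF kl(2,3) Q[OF kl(2,3)] B])
  qed
  have 3: "\<forall>x. R c x = 0 \<longrightarrow> R c (A x) = 0"
    if c: "c \<in> {0<..} \<times> {0<..}" and A: "A \<in> wot_alg gens" for A c
  proof -
    obtain k l where kl: "c = (k, l)" "0 < k" "0 < l" using c by auto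
    show ?thesis unfolding kl(1) R
      using structure_projection_alg_invariant[OF Q[OF kl(2,3)] A] by blast
  qed
  note D = decomposition_by_absorbing_projections[where Q = R, OF W countableI_type ne 1 2 3 P']
  show ?thesis unfolding alg_eq by (intro conjI D)
qed

end
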